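(* Let $n\ge 1$, let $\mathcal{G}\subseteq\mathcal{M}_n(\mathbb{C})$ be a completely reducible group of invertible matrices and let $\mathcal{A}\subseteq\mathcal{M}_n(\mathbb{C})$ be a $\mathcal{G}$-invariant commutative semisimple algebra. Suppose that every non-abelian subquotient of $\mathcal{G}$ (as an abstract group) contains a non-central abelian normal subgroup. Then $\mathcal{A}$ is contained in a $\mathcal{G}$-invariant maximal commutative semisimple algebra $\mathcal{B}\subseteq\mathcal{M}_n(\mathbb{C})$. If, in addition, $\mathcal{G}$ consists of unitary matrices and $\mathcal{A}$ is self-adjoint, then $\mathcal{B}$ can be chosen to be a masa.
   Context: $\mathcal{M}_n(\mathbb{C})$ is the algebra of $n\times n$ complex matrices. A collection $\mathcal{X}\subseteq\mathcal{M}_n(\mathbb{C})$ is completely reducible if $\mathbb{C}^n=\mathcal{V}_1+\dots+\mathcal{V}_r$ is a direct sum of $\mathcal{X}$-invariant subspaces on each of which $\mathcal{X}$ acts irreducibly (i.e. with no common nontrivial invariant subspaces). A subset $\mathcal{X}\subseteq\mathcal{M}_n(\mathbb{C})$ is $\mathcal{G}$-invariant if $G^{-1}XG\in\mathcal{X}$ for every $X\in\mathcal{X}$ and $G\in\mathcal{G}$. A subquotient of a group is a quotient of a subgroup. A commutative semisimple subalgebra of $\mathcal{M}_n(\mathbb{C})$ is one that is simultaneously diagonalizable; a maximal commutative semisimple algebra is one that is simultaneously similar to the algebra of all diagonal matrices, i.e. of the form $S\mathcal{D}_nS^{-1}$ with $S$ invertible and $\mathcal{D}_n$ the algebra of all diagonal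 matrices. A subalgebra is self-adjoint if it is closed under conjugate transpose. A masa is a maximal abelian self-adjoint subalgebra of $\mathcal{M}_n(\mathbb{C})$. *)

theory Defs
  imports "HOL-Analysis.Analysis" "HOL-Algebra.Coset"
begin

text \<open>
  The size of the matrices is \<open>CARD('n)\<close>; it is arbitrary and at least 1, since \<open>'n\<close> is a
  finite nonempty type. Subspaces of \<open>\<complex>\<^sup>n\<close> are complex subspaces (\<^const>\<open>vec.subspace\<close>), not
  the real ones of \<^const>\<open>subspace\<close>.
\<close>

definition GL :: "(complex^'n^'n) monoid" where
  "GL = \<lparr>carrier = {A. invertible A}, mult = (**), one = mat 1\<rparr>"

definition adjoint_matrix :: "complex^'n^'n \<Rightarrow> complex^'n^'n" where
  "adjoint_matrix A = (\<chi> i j. cnj (A $ j $ i))"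

definition unitary_matrix :: "complex^'n^'n \<Rightarrow> bool" where
  "unitary_matrix U \<longleftrightarrow> adjoint_matrix U ** U = mat 1 \<and> U ** adjoint_matrix U = mat 1"

definition invariant_subspace :: "(complex^'n^'n) set \<Rightarrow> (complex^'n) set \<Rightarrow> bool" where
  "invariant_subspace \<X> V \<longleftrightarrow> vec.subspace V \<and> (\<forall>X\<in>\<X>. \<forall>v\<in>V. X *v v \<in> V)"

definition acts_irreducibly :: "(complex^'n^'n) set \<Rightarrow> (complex^'n) set \<Rightarrow> bool" where
  "acts_irreducibly \<X> V \<longleftrightarrow> invariant_subspace \<X> V \<and> V \<noteq> {0} \<and>
     (\<forall>W. invariant_subspace \<X> W \<and> W \<subseteq> V \<longrightarrow> W = {0} \<or> W = V)"

text \<open>Each vector is uniquely a sum of components from the summands; \<open>\<Pi>\<^sub>E\<close> makes the family of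
  components canonical outside the index set.\<close>

definition is_direct_sum :: "nat \<Rightarrow> (nat \<Rightarrow> (complex^'n) set) \<Rightarrow> bool" where
  "is_direct_sum r V \<longleftrightarrow>
     (\<forall>v. \<exists>!f. f \<in> (\<Pi>\<^sub>E i\<in>{..<r}. V i) \<and> v = (\<Sum>i<r. f i))"

definition completely_reducible :: "(complex^'n^'n) set \<Rightarrow> bool" where
  "completely_reducible \<X> \<longleftrightarrow>
     (\<exists>r V. (\<forall>i<r. acts_irreducibly \<X> (V i)) \<and> is_direct_sum r V)"

definition conj_invariant :: "(complex^'n^'n) set \<Rightarrow> (complex^'n^'n) set \<Rightarrow> bool" where
  "conj_invariant \<G> \<X> \<longleftrightarrow> (\<forall>X\<in>\<X>. \<forall>G\<in>\<G>. matrix_inv G ** X ** G \<in> \<X>)"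

text \<open>Subalgebras are not required to contain the identity matrix.\<close>

definition matrix_subalgebra :: "(complex^'n^'n) set \<Rightarrow> bool" where
  "matrix_subalgebra \<A> \<longleftrightarrow> 0 \<in> \<A> \<and>
     (\<forall>X\<in>\<A>. \<forall>Y\<in>\<A>. X + Y \<in> \<A>) \<and>
     (\<forall>c. \<forall>X\<in>\<A>. (\<chi> i j. c * X $ i $ j) \<in> \<A>) \<and>
     (\<forall>X\<in>\<A>. \<forall>Y\<in>\<A>. X ** Y \<in> \<A>)"

definition diagonal_matrices :: "(complex^'n^'n) set" where
  "diagonal_matrices = {D. \<forall>i j. i \<noteq> j \<longrightarrow> D $ i $ j = 0}"

definition comm_semisimple_algebra :: "(complex^'n^'n) set \<Rightarrow> bool" where
  "comm_semisimple_algebra \<A> \<longleftrightarrow> matrix_subalgebra \<A> \<and>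
     (\<exists>S :: complex^'n^'n. invertible S \<and> (\<forall>X\<in>\<A>. matrix_inv S ** X ** S \<in> diagonal_matrices))"

definition max_comm_semisimple_algebra :: "(complex^'n^'n) set \<Rightarrow> bool" where
  "max_comm_semisimple_algebra \<B> \<longleftrightarrow>
     (\<exists>S :: complex^'n^'n. invertible S \<and> \<B> = (\<lambda>D. S ** D ** matrix_inv S) ` diagonal_matrices)"

definition self_adjoint_set :: "(complex^'n^'n) set \<Rightarrow> bool" where
  "self_adjoint_set \<A> \<longleftrightarrow> (\<forall>X\<in>\<A>. adjoint_matrix X \<in> \<A>)"

definition abelian_self_adjoint_algebra :: "(complex^'n^'n) set \<Rightarrow> bool" where
  "abelian_self_adjoint_algebra \<A> \<longleftrightarrow> matrix_subalgebra \<A> \<and> self_adjoint_set \<A> \<and>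
     (\<forall>X\<in>\<A>. \<forall>Y\<in>\<A>. X ** Y = Y ** X)"

definition masa :: "(complex^'n^'n) set \<Rightarrow> bool" where
  "masa \<B> \<longleftrightarrow> abelian_self_adjoint_algebra \<B> \<and>
     (\<forall>\<C>. abelian_self_adjoint_algebra \<C> \<and> \<B> \<subseteq> \<C> \<longrightarrow> \<C> = \<B>)"

definition group_center :: "('a, 'b) monoid_scheme \<Rightarrow> 'a set" where
  "group_center K = {z \<in> carrier K. \<forall>x\<in>carrier K. z \<otimes>\<^bsub>K\<^esub> x = x \<otimes>\<^bsub>K\<^esub> z}"

definition subquotients :: "('a, 'b) monoid_scheme \<Rightarrow> 'a set monoid set" where
  "subquotients K =
     {(K\<lparr>carrier := H\<rparr>) Mod N | H N. subgroup H K \<and> N \<lhd> (K\<lparr>carrier := H\<rparr>)}"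

definition has_noncentral_abelian_normal_subgroup :: "('a, 'b) monoid_scheme \<Rightarrow> bool" where
  "has_noncentral_abelian_normal_subgroup K \<longleftrightarrow>
     (\<exists>M. M \<lhd> K \<and> comm_group (K\<lparr>carrier := M\<rparr>) \<and> \<not> M \<subseteq> group_center K)"

end

theory Submission
  imports Defs "HOL-Computational_Algebra.Fundamental_Theorem_Algebra"
begin

text \<open>
  Take a maximal \<open>\<G>\<close>-invariant family \<open>P\<close> of commuting idempotents (orthogonal projections in the
  unitary case) that contains the spectral idempotents of \<open>\<A>\<close>. Its minimal nonzero members split
  \<open>\<complex>\<^sup>n\<close> into blocks which \<open>\<G>\<close> permutes and on which \<open>\<A>\<close> acts by scalars; if all blocks are lines,
  the matrices diagonal with respect to them form \<open>\<B>\<close>. For a block \<open>e\<close> let \<open>Q\<close> be the group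
  induced on it by its stabilizer, a subquotient of \<open>\<G>\<close>. A normal set of commuting operators in \<open>Q\<close>
  has the whole block as the span of its joint eigenvectors, by complete reducibility, so the
  spectral idempotents of its members commute with their \<open>\<G>\<close>-conjugates and belong to \<open>P\<close> by
  maximality; minimality of \<open>e\<close> makes the operators scalar. Hence abelian normal subgroups of
  \<open>Q\<close> are central, so \<open>Q\<close> is abelian and therefore scalar, and then any rank one idempotent below
  \<open>e\<close> (orthogonal if need be) is itself in \<open>P\<close>, so that it equals \<open>e\<close>.
\<close>

subsection \<open>Eigenvectors and spectral idempotents\<close>

text \<open>This is the vector p(A)v, evaluated by Horner's scheme on the coefficients of
  \<open>p\<close>.\<close>

definition krylov :: "'a::field^'n^'n \<Rightarrow> 'a^'n \<Rightarrow> 'a poly \<Rightarrow> 'a^'n" where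
  "krylov A v p = fold_coeffs (\<lambda>a w. a *s v + A *v w) p 0"

lemma krylov_0 [simp]: "krylov A v 0 = 0"
  by (simp add: krylov_def)

lemma krylov_pCons [simp]: "krylov A v (pCons a p) = a *s v + A *v krylov A v p"
  by (cases "a = 0 \<and> p = 0") (auto simp: krylov_def)

lemma krylov_add: "krylov A v (p + q) = krylov A v p + krylov A v q"
  by (induction p q rule: poly_induct2) (auto simp: algebra_simps vec.scale_left_distrib)

lemma krylov_smult: "krylov A v (smult c p) = c *s krylov A v p"
  by (induction p) (auto simp: algebra_simps vec.scale_right_distrib vector_scalar_commute)

lemma krylov_diff: "krylov A v (p - q) = krylov A v p - krylov A v q"
  using krylov_add[of A v "p - q" q] by simp

lemma krylov_sum: "krylov A v (sum f I) = (\<Sum>i\<in>I. krylov A v (f i))"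
  by (induction I rule: infinite_finite_induct) (auto simp: krylov_add)

lemma krylov_monom: "krylov A v (monom c i) = c *s (((*v) A ^^ i) v)"
  by (induction i) (auto simp: monom_0 monom_Suc vector_scalar_commute)

lemma krylov_in_invariant:
  assumes "vec.subspace U" "\<And>u. u \<in> U \<Longrightarrow> A *v u \<in> U" "v \<in> U"
  shows "krylov A v p \<in> U"
  by (induction p) (auto intro!: vec.subspace_0 vec.subspace_add vec.subspace_scale assms)

text \<open>The iterates of \<open>v\<close> with exponents 0 to \<open>CARD('n)\<close> are one too
  many to be independent, and the coefficients of a linear relation among them form
  \<open>p\<close>.\<close>

lemma krylov_annihilator:
  fixes A :: "'a::field^'n^'n"
  shows "\<exists>p. p \<noteq> 0 \<and> krylov A v p = 0"
proof -
  define w where "w i = ((*v) A ^^ i) v" for i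
  let ?I = "{..CARD('n)}"
  show ?thesis
  proof (cases "inj_on w ?I")
    case True
    then have "card (w ` ?I) = Suc CARD('n)"
      by (simp add: card_image)
    moreover have "card (w ` ?I) \<le> CARD('n)" if "vec.independent (w ` ?I)"
      using vec.independent_card_le_dim[OF subset_UNIV that] by (metis vec_dim_card)
    ultimately have "vec.dependent (w ` ?I)"
      by fastforce
    then obtain u x where u: "x \<in> w ` ?I" "u x \<noteq> 0" "(\<Sum>x\<in>w ` ?I. u x *s x) = 0"
      unfolding vec.dependent_finite[OF finite_imageI[OF finite_atMost]] by auto
    define p where "p = (\<Sum>i\<in>?I. monom (u (w i)) i)"
    from u obtain i where i: "i \<in> ?I" "x = w i" by auto
    have "coeff p i = u (w i)"
      using i by (simp add: p_def coeff_sum)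
    then have "p \<noteq> 0" using u i by auto
    moreover have "krylov A v p = 0"
      using u(3) sum.reindex[OF True, of "\<lambda>x. u x *s x"]
      by (simp add: p_def krylov_sum krylov_monom w_def)
    ultimately show ?thesis by blast
  next
    \<comment> \<open>A repeated iterate shrinks the set, so counting gives nothing; the equality
      \<open>w i = w j\<close> itself yields the polynomial x^i - x^j.\<close>
    case False
    then obtain i j where ij: "w i = w j" "i \<noteq> j" by (auto simp: inj_on_def)
    define p where "p = monom (1::'a) i + monom (-1) j"
    have "coeff p i = 1" using ij by (simp add: p_def)
    then have "p \<noteq> 0" by auto
    moreover have "krylov A v p = 0"
      using ij by (simp add: p_def krylov_add krylov_monom w_def)
    ultimately show ?thesis by blast
  qed
qed

text \<open>Choose a nonzero \<open>p\<close> of least degree that annihilates some nonzero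
  \<open>u\<close> in \<open>U\<close>. Over the complex numbers it has a linear factor x - c, with
  cofactor \<open>q\<close>. By minimality q(A)u is nonzero, and A - c kills it.\<close>

lemma eigenvector_in_invariant_subspace:
  fixes A :: "complex^'n^'n"
  assumes U: "vec.subspace U" "U \<noteq> {0}" and inv: "\<And>u. u \<in> U \<Longrightarrow> A *v u \<in> U"
  shows "\<exists>c. \<exists>u\<in>U. u \<noteq> 0 \<and> A *v u = c *s u"
proof -
  define P where "P p \<longleftrightarrow> p \<noteq> 0 \<and> (\<exists>u\<in>U. u \<noteq> 0 \<and> krylov A u p = 0)" for p
  obtain v where "v \<in> U" "v \<noteq> 0" using U vec.subspace_0 by blast
  then have "\<exists>p. P p" using krylov_annihilator[of A v] by (auto simp: P_def)
  then obtain p where p: "P p" and min: "\<And>q. P q \<Longrightarrow> degree p \<le> degree q"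
    using ex_has_least_nat[of P _ degree] by blast
  then obtain u where u: "u \<in> U" "u \<noteq> 0" "krylov A u p = 0" by (auto simp: P_def)
  have "degree p \<noteq> 0"
  proof
    assume "degree p = 0"
    then obtain a where "p = [:a:]" by (rule degree_eq_zeroE)
    with p u show False by (auto simp: P_def)
  qed
  then have "\<not> constant (poly p)"
    by (simp add: constant_degree)
  then obtain c where "poly p c = 0"
    using fundamental_theorem_of_algebra by blast
  then obtain q where q: "p = [:-c, 1:] * q"
    by (auto simp: poly_eq_0_iff_dvd)
  have q0: "q \<noteq> 0" using p q by (auto simp: P_def)
  define x where "x = krylov A u q"
  have "x \<in> U" unfolding x_def using krylov_in_invariant U inv u by blast
  moreover have "x \<noteq> 0"
  proof
    assume "x = 0"
    then have "P q" using q0 u by (auto simp: P_def x_def)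
    from min[OF this] show False using q q0 degree_mult_eq[of "[:-c, 1:]" q] by simp
  qed
  moreover have "A *v x = c *s x"
    using u(3) by (simp add: q krylov_diff krylov_smult x_def)
  ultimately show ?thesis by blast
qed

text \<open>By commutativity, the eigenspaces of one member are invariant under all others, so an
  invariant subspace of least dimension consists of joint eigenvectors.\<close>

lemma joint_eigenvector:
  fixes M :: "(complex^'n^'n) set"
  assumes U: "vec.subspace U" "U \<noteq> {0}" and inv: "\<And>A u. A \<in> M \<Longrightarrow> u \<in> U \<Longrightarrow> A *v u \<in> U"
    and comm: "\<And>A B u. A \<in> M \<Longrightarrow> B \<in> M \<Longrightarrow> u \<in> U \<Longrightarrow> A *v (B *v u) = B *v (A *v u)"
  shows "\<exists>u\<in>U. u \<noteq> 0 \<and> (\<forall>A\<in>M. \<exists>c. A *v u = c *s u)"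
proof -
  define P where "P W \<longleftrightarrow> vec.subspace W \<and> W \<noteq> {0} \<and> W \<subseteq> U \<and> (\<forall>A\<in>M. \<forall>u\<in>W. A *v u \<in> W)" for W
  have "P U" using U inv by (auto simp: P_def)
  then obtain W where W: "P W" and min: "\<And>W'. P W' \<Longrightarrow> vec.dim W \<le> vec.dim W'"
    using ex_has_least_nat[of P _ vec.dim] by blast
  have sub: "vec.subspace W" using W by (auto simp: P_def)
  have scal: "\<exists>c. \<forall>w\<in>W. A *v w = c *s w" if A: "A \<in> M" for A
  proof -
    obtain c u where c: "u \<in> W" "u \<noteq> 0" "A *v u = c *s u"
      using eigenvector_in_invariant_subspace[of W A] W A unfolding P_def by blast
    define W' where "W' = {w\<in>W. A *v w = c *s w}"
    have "P W'"
      unfolding P_def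
    proof (intro conjI ballI)
      show "vec.subspace W'"
        unfolding vec.subspace_def W'_def using sub
        by (auto simp: vec.subspace_def matrix_vector_right_distrib vec.scale_right_distrib
            vector_scalar_commute)
      show "W' \<noteq> {0}" using c by (auto simp: W'_def)
      show "W' \<subseteq> U" using W by (auto simp: P_def W'_def)
      fix B u assume B: "B \<in> M" "u \<in> W'"
      then have "u \<in> W" "A *v u = c *s u" by (auto simp: W'_def)
      moreover from this have "A *v (B *v u) = B *v (A *v u)"
        using comm[OF A B(1)] W by (auto simp: P_def)
      ultimately show "B *v u \<in> W'"
        using B W by (auto simp: P_def W'_def vector_scalar_commute)
    qed
    then have "W' = W"
      using min[of W'] sub by (intro vec.subspace_dim_equal) (auto simp: P_def W'_def)
    then show ?thesis by (auto simp: W'_def)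
  qed
  obtain w where "w \<in> W" "w \<noteq> 0" using W vec.subspace_0 unfolding P_def by blast
  moreover from this have "w \<in> U" "\<And>A. A \<in> M \<Longrightarrow> \<exists>c. A *v w = c *s w"
    using scal W unfolding P_def by fast+
  ultimately show ?thesis by fast
qed

text \<open>The \<open>K\<close>-component of a vector is unique because \<open>K\<close> and
  \<open>R\<close> meet in 0; uniqueness makes it linear in the vector, hence given by a
  matrix.\<close>

lemma projection_along_complement:
  fixes K R :: "('a::field^'n) set"
  assumes K: "vec.subspace K" and R: "vec.subspace R" and disj: "K \<inter> R = {0}"
    and span: "\<And>v. \<exists>k\<in>K. \<exists>r\<in>R. v = k + r"
  shows "\<exists>d. (\<forall>k\<in>K. d *v k = k) \<and> (\<forall>r\<in>R. d *v r = 0) \<and> (\<forall>v. d *v v \<in> K \<and> v - d *v v \<in> R)"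
proof -
  have uniq: "k = k'" if "k \<in> K" "k' \<in> K" "v - k \<in> R" "v - k' \<in> R" for v k k'
  proof -
    have "(v - k') - (v - k) \<in> R" using vec.subspace_diff[OF R] that by blast
    moreover have "k - k' \<in> K" using vec.subspace_diff[OF K] that by blast
    ultimately have "k - k' \<in> K \<inter> R" by simp
    then show ?thesis by (simp add: disj)
  qed
  have ex: "\<exists>k. k \<in> K \<and> v - k \<in> R" for v
    using span[of v] by force
  define f where "f v = (SOME k. k \<in> K \<and> v - k \<in> R)" for v
  have f: "f v \<in> K" "v - f v \<in> R" for v
    using someI_ex[OF ex[of v]] by (auto simp: f_def)
  have eq: "f v = k" if "k \<in> K" "v - k \<in> R" for v k
    using uniq f that by blast
  have "Vector_Spaces.linear (*s) (*s) f"
  proof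
    fix x y :: "'a^'n"
    show "f (x + y) = f x + f y"
    proof (rule eq)
      have "(x - f x) + (y - f y) \<in> R" using f vec.subspace_add[OF R] by blast
      then show "x + y - (f x + f y) \<in> R" by (simp add: algebra_simps)
    qed (use f vec.subspace_add[OF K] in blast)
  next
    fix c and x :: "'a^'n"
    show "f (c *s x) = c *s f x"
    proof (rule eq)
      show "c *s f x \<in> K" using f(1) by (rule vec.subspace_scale[OF K])
      show "c *s x - c *s f x \<in> R"
        using vec.subspace_scale[OF R f(2)] by (simp only: vec.scale_right_diff_distrib)
    qed
  qed
  then have "matrix f *v v = f v" for v
    by (rule matrix_works)
  then have "(\<forall>k\<in>K. matrix f *v k = k) \<and> (\<forall>r\<in>R. matrix f *v r = 0) \<and>
      (\<forall>v. matrix f *v v \<in> K \<and> v - matrix f *v v \<in> R)"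
    using f by (auto intro!: eq vec.subspace_0[OF K] vec.subspace_0[OF R])
  then show ?thesis by blast
qed

text \<open>Both parts of the decomposition into \<open>ker (A - c)\<close> and \<open>ran (A - c)\<close> are invariant under
  the commutant of \<open>A\<close>, hence so is the projection.\<close>

lemma eigenprojection:
  fixes A :: "'a::field^'n^'n"
  assumes diag: "vec.span {v. \<exists>c. A *v v = c *s v} = UNIV"
  shows "\<exists>d. d ** d = d \<and> (\<forall>v. A *v v = c *s v \<longrightarrow> d *v v = v) \<and> (\<forall>v. A *v (d *v v) = c *s (d *v v))
    \<and> (\<forall>B. A ** B = B ** A \<longrightarrow> d ** B = B ** d)"
proof -
  define N where "N = A - mat c"
  have N: "N *v v = A *v v - c *s v" for v
    by (simp add: N_def matrix_vector_mult_diff_rdistrib)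
       (simp add: vec_eq_iff matrix_vector_mult_def mat_def if_distrib if_distribR cong: if_cong)
  define K where "K = {v. N *v v = 0}"
  define R where "R = range ((*v) N)"
  have K: "vec.subspace K"
    by (auto simp: K_def vec.subspace_def matrix_vector_right_distrib vector_scalar_commute)
  have R: "vec.subspace R"
    unfolding R_def vec.subspace_def
    by (auto simp flip: matrix_vector_right_distrib vector_scalar_commute intro: range_eqI[of _ _ 0])
  define S where "S = {x + y | x y. x \<in> K \<and> y \<in> R}"
  have S: "vec.subspace S"
    unfolding S_def using K R by (rule vec.subspace_sums)
  have "{v. \<exists>c. A *v v = c *s v} \<subseteq> S"
  proof clarify
    fix v e assume v: "A *v v = e *s v"
    show "v \<in> S"
    proof (cases "e = c")
      case True
      then have "v \<in> K" using v by (simp add: K_def N)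
      then show ?thesis using vec.subspace_0[OF R] by (force simp: S_def)
    next
      case False
      \<comment> \<open>\<open>N\<close> multiplies this eigenvector by a nonzero scalar, so
        dividing by it exhibits the vector in the range of \<open>N\<close>.\<close>
      have "N *v v = (e - c) *s v"
        by (simp only: N v vec.scale_left_diff_distrib)
      then have "N *v (inverse (e - c) *s v) = (inverse (e - c) * (e - c)) *s v"
        by (simp only: vector_scalar_commute vec.scale_scale)
      with False have "N *v (inverse (e - c) *s v) = v"
        by simp
      then have "v \<in> R" unfolding R_def by (metis rangeI)
      then show ?thesis using vec.subspace_0[OF K] by (force simp: S_def)
    qed
  qed
  then have "vec.span {v. \<exists>c. A *v v = c *s v} \<subseteq> S"
    using S by (rule vec.span_minimal)
  then have S_UNIV: "S = UNIV" using diag by auto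
  \<comment> \<open>A basis of eigenvectors makes \<open>N\<close> diagonal with entries
    \<open>ev b - c\<close>, which excludes a nilpotent part.\<close>
  obtain B where B: "B \<subseteq> {v. \<exists>c. A *v v = c *s v}" "vec.independent B" "vec.span B = UNIV"
  proof (rule vec.basis_exists[of "{v. \<exists>c. A *v v = c *s v}"])
    fix B assume B: "B \<subseteq> {v. \<exists>c. A *v v = c *s v}" "vec.independent B"
      "{v. \<exists>c. A *v v = c *s v} \<subseteq> vec.span B"
    then have "vec.span B = UNIV"
      using vec.span_minimal[OF B(3) vec.subspace_span] by (simp add: diag top.extremum_unique)
    with B show ?thesis using that by blast
  qed
  have "\<forall>b\<in>B. \<exists>c. A *v b = c *s b" using B(1) by auto
  then obtain ev where ev: "\<And>b. b \<in> B \<Longrightarrow> A *v b = ev b *s b"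
    by (auto dest!: bchoice)
  have fin: "finite B" using B(2) by (rule vec.finiteI_independent)
  have NB: "N *v (\<Sum>b\<in>B. u b *s b) = (\<Sum>b\<in>B. (u b * (ev b - c)) *s b)" for u
  proof -
    have "N *v (\<Sum>b\<in>B. u b *s b) = (\<Sum>b\<in>B. u b *s (N *v b))"
      by (simp only: vec.sum vector_scalar_commute)
    also have "\<dots> = (\<Sum>b\<in>B. (u b * (ev b - c)) *s b)"
      by (rule sum.cong) (simp_all only: N ev vec.scale_scale flip: vec.scale_left_diff_distrib)
    finally show ?thesis .
  qed
  \<comment> \<open>In the eigenbasis, N(Nv) = 0 says that each coordinate of v times the square of
    its diagonal entry is 0; then the product without the square is 0 as well, that is, Nv =
    0.\<close>
  have "r = 0" if r: "r \<in> K" "r \<in> R" for r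
  proof -
    obtain v where v: "r = N *v v" using r(2) unfolding R_def by blast
    have "v \<in> range (\<lambda>u. \<Sum>b\<in>B. u b *s b)"
      using B(3) vec.span_finite[OF fin] by simp
    then obtain u where u: "v = (\<Sum>b\<in>B. u b *s b)"
      by blast
    have "N *v (N *v v) = 0" using r v by (simp add: K_def)
    then have "(\<Sum>b\<in>B. (u b * (ev b - c) * (ev b - c)) *s b) = 0"
      by (simp add: u NB)
    then have 0: "u b * (ev b - c) = 0" if "b \<in> B" for b
      using vec.independentD[OF B(2) fin subset_refl _ that, of "\<lambda>b. u b * (ev b - c) * (ev b - c)"]
      by auto
    show ?thesis unfolding v u NB by (intro sum.neutral ballI) (simp only: 0 vec.scale_zero_left)
  qed
  then have "K \<inter> R = {0}"
    using K R vec.subspace_0 by blast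
  then obtain d where d: "\<And>k. k \<in> K \<Longrightarrow> d *v k = k" "\<And>r. r \<in> R \<Longrightarrow> d *v r = 0"
      "\<And>v. d *v v \<in> K"  "\<And>v. v - d *v v \<in> R"
  proof -
    have "\<exists>k\<in>K. \<exists>r\<in>R. v = k + r" for v
    proof -
      have "v \<in> S" using S_UNIV by simp
      then show ?thesis unfolding S_def by blast
    qed
    from projection_along_complement[OF K R \<open>K \<inter> R = {0}\<close> this] that show ?thesis by blast
  qed
  have "d ** d = d"
    using d by (simp add: matrix_eq flip: matrix_vector_mul_assoc)
  moreover have "d ** B = B ** d" if B: "A ** B = B ** A" for B
  proof -
    have NB: "N *v (B *v v) = B *v (N *v v)" for v
      using arg_cong[OF B, of "\<lambda>X. X *v v"]
      by (simp add: N matrix_vector_mult_diff_distrib vector_scalar_commute flip: matrix_vector_mul_assoc)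
    have "B *v (d *v v) \<in> K" for v
      using d(3)[of v] by (simp add: K_def NB)
    moreover have "B *v (v - d *v v) \<in> R" for v
    proof -
      obtain x where "v - d *v v = N *v x" using d(4)[of v] unfolding R_def by blast
      then show ?thesis unfolding R_def using NB by (metis rangeI)
    qed
    ultimately have "d *v (B *v v) = B *v (d *v v)" for v
      using d(1)[of "B *v (d *v v)"] d(2)[of "B *v (v - d *v v)"]
      by (simp add: matrix_vector_mult_diff_distrib)
    then show ?thesis by (simp add: matrix_eq flip: matrix_vector_mul_assoc)
  qed
  moreover have "d *v v = v" if "A *v v = c *s v" for v
    by (rule d(1)) (simp add: K_def N that)
  moreover have "A *v (d *v v) = c *s (d *v v)" for v
    using d(3)[of v] by (simp add: K_def N)
  ultimately show ?thesis by blast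
qed

section \<open>Adjoints and normal idempotents\<close>

lemma matrix_mul_lzero [simp]: "0 ** X = (0 :: 'a::semiring_1^'n^'m)"
  by (simp add: matrix_matrix_mult_def vec_eq_iff)

lemma matrix_mul_rzero [simp]: "X ** 0 = (0 :: 'a::semiring_1^'n^'m)"
  by (simp add: matrix_matrix_mult_def vec_eq_iff)

lemma adjoint_matrix_mul: "adjoint_matrix (A ** B) = adjoint_matrix B ** adjoint_matrix A"
  by (simp add: adjoint_matrix_def matrix_matrix_mult_def vec_eq_iff mult.commute)

lemma adjoint_matrix_adjoint [simp]: "adjoint_matrix (adjoint_matrix A) = A"
  by (simp add: adjoint_matrix_def)

definition cinner :: "complex^'n \<Rightarrow> complex^'n \<Rightarrow> complex" where
  "cinner u v = (\<Sum>i\<in>UNIV. u $ i * cnj (v $ i))"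

lemma cinner_adjoint: "cinner (A *v u) v = cinner u (adjoint_matrix A *v v)"
proof -
  have "cinner (A *v u) v = (\<Sum>i\<in>UNIV. \<Sum>j\<in>UNIV. A $ i $ j * u $ j * cnj (v $ i))"
    by (simp add: cinner_def matrix_vector_mult_def sum_distrib_right)
  also have "\<dots> = (\<Sum>j\<in>UNIV. \<Sum>i\<in>UNIV. A $ i $ j * u $ j * cnj (v $ i))"
    by (rule sum.swap)
  also have "\<dots> = cinner u (adjoint_matrix A *v v)"
    by (simp add: cinner_def matrix_vector_mult_def adjoint_matrix_def sum_distrib_left mult_ac)
  finally show ?thesis .
qed

lemma cinner_self_eq_0: "cinner v v = 0 \<longleftrightarrow> v = 0"
proof
  assume "cinner v v = 0"
  moreover have "cinner v v = of_real (\<Sum>i\<in>UNIV. (cmod (v $ i))\<^sup>2)"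
    by (simp only: cinner_def complex_norm_square of_real_sum)
  ultimately have "(\<Sum>i\<in>UNIV. (cmod (v $ i))\<^sup>2) = 0"
    by (simp only: of_real_eq_0_iff)
  then show "v = 0"
    by (simp add: sum_nonneg_eq_0_iff vec_eq_iff)
qed (simp add: cinner_def)

text \<open>With N* for the adjoint, the squared norm of N*v is the inner product of v with NN*v =
  N*Nv = 0.\<close>

lemma normal_kernel:
  assumes "N ** adjoint_matrix N = adjoint_matrix N ** N" "N *v v = 0"
  shows "adjoint_matrix N *v v = 0"
proof -
  have "cinner (adjoint_matrix N *v v) (adjoint_matrix N *v v) = cinner v (N *v (adjoint_matrix N *v v))"
    using cinner_adjoint[of "adjoint_matrix N"] by simp
  also have "N *v (adjoint_matrix N *v v) = 0"
    using assms by (metis matrix_vector_mul_assoc matrix_vector_mult_0_right)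
  finally have "cinner (adjoint_matrix N *v v) (adjoint_matrix N *v v) = 0"
    by (simp add: cinner_def)
  then show ?thesis
    by (simp only: cinner_self_eq_0)
qed

lemma adjoint_matrix_id_minus: "adjoint_matrix (mat 1 - d) = mat 1 - adjoint_matrix d"
  by (auto simp: adjoint_matrix_def vec_eq_iff mat_def)

lemma matrix_mul_id_minus:
  "X ** (mat 1 - d) = X - X ** d" "(mat 1 - d) ** X = X - d ** (X :: complex^'n^'n)"
  by (simp_all add: matrix_eq matrix_vector_mult_diff_rdistrib matrix_vector_mult_diff_distrib
      flip: matrix_vector_mul_assoc)

text \<open>Both \<open>d\<close> and \<open>mat 1 - d\<close> are normal, so
  \<open>normal_kernel\<close> applies to each: the adjoint of \<open>d\<close> kills the kernel of
  \<open>d\<close> and fixes its range, as \<open>d\<close> does.\<close>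

lemma normal_idempotent_self_adjoint:
  assumes d: "d ** d = d" and normal: "d ** adjoint_matrix d = adjoint_matrix d ** d"
  shows "adjoint_matrix d = d"
proof -
  let ?d = "adjoint_matrix d"
  have 1: "?d *v (v - d *v v) = 0" for v
    by (rule normal_kernel[OF normal])
      (simp add: matrix_vector_mult_diff_distrib matrix_vector_mul_assoc d)
  have 2: "adjoint_matrix (mat 1 - d) *v (d *v v) = 0" for v
  proof (rule normal_kernel)
    show "(mat 1 - d) ** adjoint_matrix (mat 1 - d) = adjoint_matrix (mat 1 - d) ** (mat 1 - d)"
      by (simp add: adjoint_matrix_id_minus matrix_mul_id_minus normal algebra_simps)
    show "(mat 1 - d) *v (d *v v) = 0"
      by (simp add: matrix_vector_mul_assoc matrix_mul_id_minus d)
  qed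
  have "?d *v v = d *v v" for v
    using 1[of v] 2[of v]
    by (simp add: adjoint_matrix_id_minus matrix_vector_mult_diff_rdistrib matrix_vector_mult_diff_distrib)
  then show ?thesis
    by (simp add: matrix_eq)
qed

section \<open>Invariant complements from complete reducibility\<close>

lemma invariant_subspace_sum:
  assumes "invariant_subspace X U" "invariant_subspace X W"
  shows "invariant_subspace X {u + w | u w. u \<in> U \<and> w \<in> W}"
proof -
  have "vec.subspace {u + w | u w. u \<in> U \<and> w \<in> W}"
    using assms by (intro vec.subspace_sums) (auto simp: invariant_subspace_def)
  moreover have "A *v (u + w) \<in> {u + w | u w. u \<in> U \<and> w \<in> W}"
    if "A \<in> X" "u \<in> U" "w \<in> W" for A u w
    using that assms unfolding invariant_subspace_def matrix_vector_right_distrib by blast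
  ultimately show ?thesis
    unfolding invariant_subspace_def by blast
qed

text \<open>Complete reducibility enters the argument only in this form. The projection onto
  \<open>U\<close> along \<open>W\<close> commutes with all of \<open>X\<close>.\<close>

lemma completely_reducible_complement:
  fixes X :: "(complex^'n^'n) set"
  assumes cr: "completely_reducible X" and W: "invariant_subspace X W"
  shows "\<exists>U. invariant_subspace X U \<and> U \<inter> W = {0} \<and> (\<forall>v. \<exists>u\<in>U. \<exists>w\<in>W. v = u + w)"
proof -
  define Q where "Q U \<longleftrightarrow> invariant_subspace X U \<and> U \<inter> W = {0}" for U
  have W0: "vec.subspace W" using W by (simp add: invariant_subspace_def)
  \<comment> \<open>An invariant subspace of largest dimension among those disjoint from \<open>W\<close> is a complement: it
    can be enlarged by any irreducible summand not contained in \<open>S\<close>.\<close>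
  have "Q {0}"
    using vec.subspace_0[OF W0] by (auto simp: Q_def invariant_subspace_def)
  moreover have "vec.dim U \<le> CARD('n)" for U :: "(complex^'n) set"
    using vec.dim_subset[OF subset_UNIV] by (simp only: vec_dim_card)
  \<comment> \<open>The rule for a greatest value asks for a strict bound on the dimension, hence
    the \<open>Suc\<close>.\<close>
  ultimately obtain U where U: "Q U" and max: "\<And>U'. Q U' \<Longrightarrow> vec.dim U' \<le> vec.dim U"
    using ex_has_greatest_nat[of Q "{0}" vec.dim "Suc CARD('n)"] by (auto simp: less_Suc_eq_le)
  have U0: "vec.subspace U" and invU: "invariant_subspace X U" and disj: "U \<inter> W = {0}"
    using U by (auto simp: Q_def invariant_subspace_def)
  define S where "S = {u + w | u w. u \<in> U \<and> w \<in> W}"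
  have S: "invariant_subspace X S"
    unfolding S_def by (rule invariant_subspace_sum[OF invU W])
  have S0: "vec.subspace S" using S by (simp add: invariant_subspace_def)
  have US: "U \<subseteq> S" and WS: "W \<subseteq> S"
    using vec.subspace_0[OF W0] vec.subspace_0[OF U0] unfolding S_def by force+
  have irr: "V \<subseteq> S" if V: "acts_irreducibly X V" for V
  proof (rule ccontr)
    assume nsub: "\<not> V \<subseteq> S"
    have invV: "invariant_subspace X V" and V0: "vec.subspace V"
      using V by (auto simp: acts_irreducibly_def invariant_subspace_def)
    have "invariant_subspace X (V \<inter> S)"
      using invV S by (auto simp: invariant_subspace_def vec.subspace_inter)
    then have VS: "V \<inter> S = {0}"
      using V nsub unfolding acts_irreducibly_def by blast
    define U' where "U' = {u + v | u v. u \<in> U \<and> v \<in> V}"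
    have invU': "invariant_subspace X U'"
      unfolding U'_def by (rule invariant_subspace_sum[OF invU invV])
    have "x = 0" if x: "x \<in> U'" "x \<in> W" for x
    proof -
      obtain u v where uv: "x = u + v" "u \<in> U" "v \<in> V" using x(1) unfolding U'_def by blast
      have "x - u \<in> S" using x(2) uv US WS by (intro vec.subspace_diff[OF S0]) auto
      then have "v \<in> V \<inter> S" using uv by simp
      then have "v = 0" using VS by simp
      then have "x \<in> U \<inter> W" using uv x by simp
      then show ?thesis using disj by simp
    qed
    then have "U' \<inter> W = {0}"
      using vec.subspace_0[of U'] invU' vec.subspace_0[OF W0] unfolding invariant_subspace_def by blast
    then have "vec.dim U' \<le> vec.dim U"
      using invU' by (intro max) (simp add: Q_def)
    moreover have UU': "U \<subseteq> U'" and VU': "V \<subseteq> U'"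
      using vec.subspace_0[OF V0] vec.subspace_0[OF U0] unfolding U'_def by force+
    moreover have "vec.subspace U'"
      using invU' by (simp add: invariant_subspace_def)
    ultimately have "U = U'"
      using U0 by (intro vec.subspace_dim_equal)
    then show False using VU' US nsub by blast
  qed
  obtain r V where V: "\<And>i. i < r \<Longrightarrow> acts_irreducibly X (V i)" and sum: "is_direct_sum r V"
    using cr unfolding completely_reducible_def by blast
  have "v \<in> S" for v
  proof -
    obtain f where f: "f \<in> (\<Pi>\<^sub>E i\<in>{..<r}. V i)" "v = (\<Sum>i<r. f i)"
      using sum unfolding is_direct_sum_def by blast
    have "f i \<in> S" if "i < r" for i
      using irr[OF V[OF that]] f(1) that by (auto simp: PiE_iff)
    then show ?thesis
      unfolding f(2) by (intro vec.subspace_sum[OF S0]) auto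
  qed
  then have "\<exists>u\<in>U. \<exists>w\<in>W. v = u + w" for v
    unfolding S_def by blast
  then show ?thesis
    using invU disj by blast
qed

subsection \<open>Maximal invariant families of commuting idempotents\<close>

text \<open>The flag \<open>sa\<close> selects the unitary version of the theorem.\<close>

definition proj :: "bool \<Rightarrow> complex^'n^'n \<Rightarrow> bool" where
  "proj sa d \<longleftrightarrow> d ** d = d \<and> (sa \<longrightarrow> adjoint_matrix d = d)"

lemma proj_idem [simp]: "proj sa d \<Longrightarrow> d ** d = d"
  by (simp add: proj_def)

lemma proj_mul:
  assumes "proj sa a" "proj sa b" "a ** b = b ** a"
  shows "proj sa (a ** b)"
proof -
  have "(a ** b) ** (a ** b) = (a ** a) ** (b ** b)"
    using assms(3) by (metis matrix_mul_assoc)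
  then show ?thesis using assms by (auto simp: proj_def adjoint_matrix_mul)
qed

lemma proj_id_minus: "proj sa d \<Longrightarrow> proj sa (mat 1 - d)"
  by (auto simp: proj_def adjoint_matrix_id_minus matrix_mul_id_minus)

section \<open>Conjugation as a right action of the invertible matrices\<close>

definition conjugate :: "complex^'n^'n \<Rightarrow> complex^'n^'n \<Rightarrow> complex^'n^'n" where
  "conjugate g X = matrix_inv g ** X ** g"

lemma matrix_inv_cancel:
  fixes g :: "complex^'n^'n"
  assumes "invertible g"
  shows "g ** matrix_inv g = mat 1" "matrix_inv g ** g = mat 1"
    "g ** (matrix_inv g ** X) = X" "matrix_inv g ** (g ** X) = X"
    "X ** g ** matrix_inv g = X" "X ** matrix_inv g ** g = X"
proof -
  have "g ** matrix_inv g = mat 1 \<and> matrix_inv g ** g = mat 1"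
    using assms unfolding invertible_def matrix_inv_def by (rule someI_ex)
  then show "g ** matrix_inv g = mat 1" "matrix_inv g ** g = mat 1"
    "g ** (matrix_inv g ** X) = X" "matrix_inv g ** (g ** X) = X"
    "X ** g ** matrix_inv g = X" "X ** matrix_inv g ** g = X"
    by (simp_all add: matrix_mul_assoc) (simp_all flip: matrix_mul_assoc)
qed

lemma matrix_inv_unique:
  fixes g :: "complex^'n^'n"
  assumes "g ** h = mat 1"
  shows "matrix_inv g = h"
proof -
  have "invertible g" using assms by (auto simp: invertible_right_inverse)
  then show ?thesis using matrix_inv_cancel(4)[of g h] assms by simp
qed

lemma matrix_inv_mul:
  fixes g h :: "complex^'n^'n"
  assumes "invertible g" "invertible h"
  shows "matrix_inv (g ** h) = matrix_inv h ** matrix_inv g"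
  by (rule matrix_inv_unique) (metis assms matrix_inv_cancel(1,5) matrix_mul_assoc)

lemma matrix_inv_inv:
  fixes g :: "complex^'n^'n"
  shows "invertible g \<Longrightarrow> matrix_inv (matrix_inv g) = g"
  by (rule matrix_inv_unique) (rule matrix_inv_cancel)

lemma conjugate_mul: "invertible g \<Longrightarrow> conjugate g (X ** Y) = conjugate g X ** conjugate g Y"
  by (simp add: conjugate_def matrix_mul_assoc matrix_inv_cancel)

lemma conjugate_conjugate:
  "invertible g \<Longrightarrow> invertible h \<Longrightarrow> conjugate h (conjugate g X) = conjugate (g ** h) X"
  by (simp add: conjugate_def matrix_mul_assoc matrix_inv_mul)

lemma conjugate_id [simp]: "conjugate (mat 1) X = (X :: complex^'n^'n)"
  unfolding conjugate_def
  using matrix_inv_unique[of "mat 1" "mat 1 :: complex^'n^'n"] by simp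

lemma conjugate_0 [simp]: "conjugate g 0 = 0"
  by (simp add: conjugate_def)

lemma conjugate_inverse:
  "invertible g \<Longrightarrow> conjugate (matrix_inv g) (conjugate g X) = X"
  "invertible g \<Longrightarrow> conjugate g (conjugate (matrix_inv g) X) = X"
  by (simp_all add: conjugate_def matrix_inv_inv matrix_mul_assoc matrix_inv_cancel)

lemma conjugate_eq_0_iff [simp]: "invertible g \<Longrightarrow> conjugate g X = 0 \<longleftrightarrow> X = 0"
  by (metis conjugate_0 conjugate_inverse(1))

lemma conjugate_eq_self_iff: "invertible g \<Longrightarrow> conjugate g X = X \<longleftrightarrow> X ** g = g ** X"
  unfolding conjugate_def by (metis matrix_inv_cancel(3,4) matrix_mul_assoc)

lemma proj_conjugate:
  assumes "invertible g" "proj sa d" "sa \<Longrightarrow> unitary_matrix g"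
  shows "proj sa (conjugate g d)"
proof -
  have "adjoint_matrix g = matrix_inv g" if sa
    using assms(3)[OF that] matrix_inv_unique[of g "adjoint_matrix g"] by (simp add: unitary_matrix_def)
  then have "adjoint_matrix (conjugate g d) = conjugate g d" if sa
    using that assms(2) by (simp add: conjugate_def adjoint_matrix_mul proj_def matrix_mul_assoc)
      (metis adjoint_matrix_adjoint matrix_mul_assoc)
  then show ?thesis
    using assms by (simp add: proj_def flip: conjugate_mul)
qed

locale matrix_group =
  fixes \<G> :: "(complex^'n^'n) set"
  assumes subgroup_GL: "subgroup \<G> GL"
begin

lemma invertible [simp]: "g \<in> \<G> \<Longrightarrow> invertible g"
  using subgroup.subset[OF subgroup_GL] by (auto simp: GL_def)

lemma mul_closed [simp]: "g \<in> \<G> \<Longrightarrow> h \<in> \<G> \<Longrightarrow> g ** h \<in> \<G>"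
  using subgroup.m_closed[OF subgroup_GL] by (simp add: GL_def)

lemma id_mem [simp]: "mat 1 \<in> \<G>"
  using subgroup.one_closed[OF subgroup_GL] by (simp add: GL_def)

lemma inv_closed [simp]: assumes g: "g \<in> \<G>" shows "matrix_inv g \<in> \<G>"
proof -
  have g': "g \<in> carrier GL" using g by (simp add: GL_def)
  have "invertible (matrix_inv g)"
    using matrix_inv_cancel[OF invertible[OF g]] by (auto simp: invertible_def)
  then have "inv\<^bsub>GL\<^esub> g = matrix_inv g"
    unfolding m_inv_def using matrix_inv_cancel[OF invertible[OF g]]
    by (intro the_equality) (auto simp: GL_def dest: matrix_inv_unique)
  then show ?thesis
    using subgroup.m_inv_closed[OF subgroup_GL g] by simp
qed

end

text \<open>These are the families among which a maximal one is sought. When \<open>sa\<close>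
  holds, the group is unitary, which keeps the conjugates of orthogonal projections
  orthogonal.\<close>

locale commuting_projections = matrix_group \<G> for \<G> :: "(complex^'n^'n) set" +
  fixes sa :: bool and P :: "(complex^'n^'n) set"
  assumes unitary: "sa \<Longrightarrow> g \<in> \<G> \<Longrightarrow> unitary_matrix g"
    and proj_P: "d \<in> P \<Longrightarrow> proj sa d"
    and comm_P: "d \<in> P \<Longrightarrow> e \<in> P \<Longrightarrow> d ** e = e ** d"
    and conjugate_P: "g \<in> \<G> \<Longrightarrow> d \<in> P \<Longrightarrow> conjugate g d \<in> P"
begin

text \<open>Conjugating back reduces every commutation relation in the enlarged family to one that
  involves \<open>d\<close> itself, so it suffices to test \<open>d\<close> against \<open>P\<close>
  and against its own conjugates.\<close>

lemma adjoin_orbit: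
  assumes d: "proj sa d" and dP: "\<And>p. p \<in> P \<Longrightarrow> d ** p = p ** d"
    and dd: "\<And>g. g \<in> \<G> \<Longrightarrow> d ** conjugate g d = conjugate g d ** d"
  shows "commuting_projections \<G> sa (P \<union> (\<lambda>g. conjugate g d) ` \<G>)"
proof unfold_locales
  show "unitary_matrix g" if "sa" "g \<in> \<G>" for g
    using unitary that .
  show "proj sa e" if "e \<in> P \<union> (\<lambda>g. conjugate g d) ` \<G>" for e
    using that proj_P proj_conjugate[OF _ d] unitary by auto
  show "conjugate g e \<in> P \<union> (\<lambda>g. conjugate g d) ` \<G>"
    if "g \<in> \<G>" "e \<in> P \<union> (\<lambda>g. conjugate g d) ` \<G>" for g e
    using that by (auto simp: conjugate_P conjugate_conjugate)
  have 1: "conjugate g d ** p = p ** conjugate g d" if "g \<in> \<G>" "p \<in> P" for g p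
  proof -
    define q where "q = conjugate (matrix_inv g) p"
    have "q \<in> P" "p = conjugate g q"
      using that by (auto simp: q_def conjugate_P conjugate_inverse)
    then show ?thesis
      using that dP by (simp flip: conjugate_mul)
  qed
  have 2: "conjugate g d ** conjugate h d = conjugate h d ** conjugate g d"
    if "g \<in> \<G>" "h \<in> \<G>" for g h
  proof -
    \<comment> \<open>With h = kg both conjugates are images under \<open>conjugate g\<close>,
      namely of \<open>d\<close> and of \<open>conjugate k d\<close>.\<close>
    define k where "k = h ** matrix_inv g"
    have k: "k \<in> \<G>" "h = k ** g"
      using that by (auto simp: k_def matrix_inv_cancel)
    then have "conjugate h d = conjugate g (conjugate k d)"
      using that by (simp add: conjugate_conjugate)
    then show ?thesis
      using that dd[OF k(1)] by (simp flip: conjugate_mul)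
  qed
  show "a ** b = b ** a"
    if "a \<in> P \<union> (\<lambda>g. conjugate g d) ` \<G>" "b \<in> P \<union> (\<lambda>g. conjugate g d) ` \<G>" for a b
    using that 1 2 comm_P by (elim UnE imageE) auto
qed

text \<open>Zorn's lemma applies since each condition concerns at most two members of the family,
  and two members of the union of a chain already lie in one link.\<close>

lemma maximal_extension:
  "\<exists>Q. P \<subseteq> Q \<and> commuting_projections \<G> sa Q \<and>
     (\<forall>R. commuting_projections \<G> sa R \<longrightarrow> Q \<subseteq> R \<longrightarrow> R = Q)"
proof -
  define \<F> where "\<F> = {Q. P \<subseteq> Q \<and> commuting_projections \<G> sa Q}"
  have "\<exists>M\<in>\<F>. \<forall>X\<in>\<F>. M \<subseteq> X \<longrightarrow> X = M"
  proof (rule subset_Zorn_nonempty)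
    have "P \<in> \<F>"
      unfolding \<F>_def using commuting_projections_axioms by simp
    then show "\<F> \<noteq> {}" by blast
    fix \<C> assume ne: "\<C> \<noteq> {}" and ch: "subset.chain \<F> \<C>"
    have C: "commuting_projections \<G> sa Q" "P \<subseteq> Q" if "Q \<in> \<C>" for Q
      using ch that by (auto simp: subset_chain_def \<F>_def)
    have "commuting_projections \<G> sa (\<Union>\<C>)"
    proof unfold_locales
      show "unitary_matrix g" if "sa" "g \<in> \<G>" for g
        using unitary that .
      show "proj sa d" if "d \<in> \<Union>\<C>" for d
        using that C commuting_projections.proj_P by blast
      show "conjugate g d \<in> \<Union>\<C>" if "g \<in> \<G>" "d \<in> \<Union>\<C>" for g d
        using that C commuting_projections.conjugate_P by blast
      fix d e assume "d \<in> \<Union>\<C>" "e \<in> \<Union>\<C>"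
      then obtain X Y where XY: "X \<in> \<C>" "Y \<in> \<C>" "d \<in> X" "e \<in> Y" by blast
      then have "X \<subseteq> Y \<or> Y \<subseteq> X" using ch by (auto simp: subset_chain_def)
      then show "d ** e = e ** d"
        using XY C(1) commuting_projections.comm_P by blast
    qed
    then show "\<Union>\<C> \<in> \<F>"
      unfolding \<F>_def using ne C by blast
  qed
  then obtain M where M: "M \<in> \<F>" and max: "\<And>X. X \<in> \<F> \<Longrightarrow> M \<subseteq> X \<Longrightarrow> X = M"
    by (auto dest: bspec)
  have "R = M" if "commuting_projections \<G> sa R" "M \<subseteq> R" for R
    using M that by (intro max) (auto simp: \<F>_def)
  with M show ?thesis
    unfolding \<F>_def by (intro exI[of _ M]) simp
qed

end

locale maximal_commuting_projections = commuting_projections \<G> sa P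
  for \<G> :: "(complex^'n^'n) set" and sa P +
  assumes maximal: "commuting_projections \<G> sa Q \<Longrightarrow> P \<subseteq> Q \<Longrightarrow> Q = P"
begin

text \<open>Maximality is exploited in this form: adjoining the orbit of \<open>d\<close> cannot
  enlarge \<open>P\<close>, and \<open>d\<close> is in its orbit through the identity.\<close>

lemma mem_P:
  assumes "proj sa d" "\<And>p. p \<in> P \<Longrightarrow> d ** p = p ** d"
    and "\<And>g. g \<in> \<G> \<Longrightarrow> d ** conjugate g d = conjugate g d ** d"
  shows "d \<in> P"
proof -
  have "P \<union> (\<lambda>g. conjugate g d) ` \<G> = P"
    using adjoin_orbit[OF assms] by (intro maximal) auto
  moreover have "d \<in> (\<lambda>g. conjugate g d) ` \<G>"
    by (rule image_eqI[of _ _ "mat 1"]) auto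
  ultimately show ?thesis by blast
qed

text \<open>Products commute with \<open>P\<close> and with their conjugates because the factors do.
  Closure under products allows atoms to be found by lowering the rank.\<close>

lemma mul_P:
  assumes a: "a \<in> P" and b: "b \<in> P"
  shows "a ** b \<in> P"
proof (rule mem_P)
  have comm: "(a ** b) ** p = p ** (a ** b)" if "p \<in> P" for p
    using comm_P[OF a that] comm_P[OF b that] by (metis matrix_mul_assoc)
  show "proj sa (a ** b)"
    using assms by (intro proj_mul proj_P comm_P)
  show "(a ** b) ** p = p ** (a ** b)" if "p \<in> P" for p
    using comm[OF that] .
  show "(a ** b) ** conjugate g (a ** b) = conjugate g (a ** b) ** (a ** b)" if g: "g \<in> \<G>" for g
  proof -
    have "conjugate g a \<in> P" "conjugate g b \<in> P" using assms g conjugate_P by auto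
    then show ?thesis
      using comm g by (simp add: conjugate_mul) (metis matrix_mul_assoc)
  qed
qed

section \<open>Atoms of the Boolean algebra of commuting idempotents\<close>

definition atom :: "complex^'n^'n \<Rightarrow> bool" where
  "atom e \<longleftrightarrow> e \<in> P \<and> e \<noteq> 0 \<and> (\<forall>d\<in>P. d ** e = 0 \<or> d ** e = e)"

lemma atom_P: "atom e \<Longrightarrow> e \<in> P"
  by (simp add: atom_def)

lemma atom_idem [simp]: "atom e \<Longrightarrow> e ** e = e"
  using atom_P proj_P proj_idem by blast

lemma atom_disjoint:
  assumes "atom a" "atom b" "a \<noteq> b"
  shows "a ** b = 0"
  using assms comm_P[of a b] unfolding atom_def by metis

lemma atom_conjugate:
  assumes e: "atom e" and g: "g \<in> \<G>"
  shows "atom (conjugate g e)"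
  unfolding atom_def
proof (intro conjI ballI)
  show "conjugate g e \<in> P" using e g conjugate_P atom_P by blast
  show "conjugate g e \<noteq> 0" using e g by (simp add: atom_def)
  fix d assume d: "d \<in> P"
  define q where "q = conjugate (matrix_inv g) d"
  have q: "q \<in> P" "d = conjugate g q"
    using d g by (auto simp: q_def conjugate_P conjugate_inverse)
  then have "q ** e = 0 \<or> q ** e = e" using e by (auto simp: atom_def)
  then show "d ** conjugate g e = 0 \<or> d ** conjugate g e = conjugate g e"
    using g q by (auto simp flip: conjugate_mul)
qed

text \<open>Take \<open>e\<close> of least rank among the nonzero members below \<open>f\<close>. A
  nonzero product \<open>d ** e\<close> again qualifies, so its range is all of the range of
  \<open>e\<close>, and \<open>d\<close> fixes that range.\<close>

lemma atom_below:
  assumes f: "f \<in> P" "f \<noteq> 0"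
  shows "\<exists>e. atom e \<and> f ** e = e"
proof -
  define Q where "Q e \<longleftrightarrow> e \<in> P \<and> e \<noteq> 0 \<and> f ** e = e" for e
  have "Q f" using f proj_idem[OF proj_P] by (simp add: Q_def)
  then obtain e where e: "Q e"
    and min: "\<And>e'. Q e' \<Longrightarrow> vec.dim (range ((*v) e)) \<le> vec.dim (range ((*v) e'))"
    using ex_has_least_nat[of Q _ "\<lambda>e. vec.dim (range ((*v) e))"] by blast
  have sub: "vec.subspace (range ((*v) X))" for X :: "complex^'n^'n"
    using vec.subspace_image[OF vec.subspace_UNIV] .
  have "d ** e = e" if d: "d \<in> P" "d ** e \<noteq> 0" for d
  proof -
    have de: "d ** e = e ** d" using d e comm_P by (auto simp: Q_def)
    have "Q (d ** e)"
      using d e mul_P comm_P[OF f(1) d(1)] unfolding Q_def by (metis matrix_mul_assoc)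
    moreover have "range ((*v) (d ** e)) \<subseteq> range ((*v) e)"
      unfolding de by (auto simp flip: matrix_vector_mul_assoc)
    ultimately have "range ((*v) (d ** e)) = range ((*v) e)"
      using min sub by (intro vec.subspace_dim_equal) auto
    then have "e *v v \<in> range ((*v) (d ** e))" for v
      by blast
    moreover have "d *v w = w" if "w \<in> range ((*v) (d ** e))" for w
      using that proj_idem[OF proj_P[OF d(1)]] by (auto simp: matrix_vector_mul_assoc matrix_mul_assoc)
    ultimately have "d *v (e *v v) = e *v v" for v
      by blast
    then show ?thesis by (simp add: matrix_eq flip: matrix_vector_mul_assoc)
  qed
  then have "atom e" using e by (auto simp: atom_def Q_def)
  then show ?thesis using e by (auto simp: Q_def)
qed

text \<open>For an idempotent below an atom, most of the commutation conditions are automatic: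
  members of \<open>P\<close> act on the block as 0 or the identity, and a group element outside the
  stabilizer moves \<open>d\<close> below a different atom, where its products with \<open>d\<close>
  vanish. Only the stabilizer has to be checked.\<close>

lemma atom_P_absorb:
  assumes e: "atom e" and d: "proj sa d" "d ** e = d" "e ** d = d"
    and stab: "\<And>h. h \<in> \<G> \<Longrightarrow> conjugate h e = e \<Longrightarrow> d ** conjugate h d = conjugate h d ** d"
  shows "d = 0 \<or> d = e"
proof -
  have "d \<in> P"
  proof (rule mem_P)
    show "proj sa d" by fact
    fix p assume p: "p \<in> P"
    have pe: "p ** e = e ** p" using p e comm_P atom_P by blast
    \<comment> \<open>Since \<open>p ** e\<close> is 0 or \<open>e\<close>, the products of
      \<open>p\<close> with \<open>d\<close> on either side are both 0 or both
      \<open>d\<close>.\<close>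
    have "p ** d = (p ** e) ** d" using d by (simp flip: matrix_mul_assoc)
    moreover have "d ** p = d ** (p ** e)"
      unfolding pe using d(2) by (simp add: matrix_mul_assoc)
    ultimately show "d ** p = p ** d"
      using e p d by (auto simp: atom_def)
  next
    fix g assume g: "g \<in> \<G>"
    show "d ** conjugate g d = conjugate g d ** d"
    proof (cases "conjugate g e = e")
      case False
      let ?e = "conjugate g e" and ?d = "conjugate g d"
      have 0: "e ** ?e = 0" "?e ** e = 0"
        using False atom_disjoint atom_conjugate e g by metis+
      have 1: "?d ** ?e = ?d" "?e ** ?d = ?d"
        using g d by (simp_all flip: conjugate_mul)
      have "d ** ?d = d ** (e ** ?e) ** ?d"
        using 1 d by (simp add: matrix_mul_assoc) (simp flip: matrix_mul_assoc)
      moreover have "?d ** d = ?d ** (?e ** e) ** d"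
        using 1 d by (simp add: matrix_mul_assoc) (simp flip: matrix_mul_assoc)
      ultimately show ?thesis using 0 by simp
    qed (use stab g in blast)
  qed
  then show ?thesis using e d by (metis atom_def)
qed

end

subsection \<open>Stabilizers of blocks\<close>

text \<open>In the unitary case \<open>d\<close> commutes with the adjoint of \<open>A\<close> by
  normality. Taking adjoints, the adjoint of \<open>d\<close> commutes with \<open>A\<close> and
  therefore with \<open>d\<close>, so \<open>d\<close> is a normal idempotent.\<close>

lemma eigenprojection_proj:
  fixes A :: "complex^'n^'n"
  assumes diag: "vec.span {v. \<exists>c. A *v v = c *s v} = UNIV"
    and normal: "sa \<Longrightarrow> A ** adjoint_matrix A = adjoint_matrix A ** A"
  obtains d where "proj sa d" "\<And>v. A *v v = c *s v \<Longrightarrow> d *v v = v"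
    "\<And>v. A *v (d *v v) = c *s (d *v v)" "\<And>B. A ** B = B ** A \<Longrightarrow> d ** B = B ** d"
proof -
  obtain d where d: "d ** d = d" "\<And>v. A *v v = c *s v \<Longrightarrow> d *v v = v"
    "\<And>v. A *v (d *v v) = c *s (d *v v)" "\<And>B. A ** B = B ** A \<Longrightarrow> d ** B = B ** d"
    using eigenprojection[OF diag, of c] by blast
  have "adjoint_matrix d = d" if sa
  proof -
    have "d ** adjoint_matrix A = adjoint_matrix A ** d"
      using d(4) normal[OF that] .
    then have "A ** adjoint_matrix d = adjoint_matrix d ** A"
      by (metis adjoint_matrix_mul adjoint_matrix_adjoint)
    then have "d ** adjoint_matrix d = adjoint_matrix d ** d"
      by (rule d(4))
    with d(1) show ?thesis
      by (rule normal_idempotent_self_adjoint)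
  qed
  with d(1) have "proj sa d" by (simp add: proj_def)
  then show ?thesis using d(2-4) by (rule that)
qed

locale reducible_projections = maximal_commuting_projections \<G> sa P
  for \<G> :: "(complex^'n^'n) set" and sa P +
  assumes cr: "completely_reducible \<G>"
begin

definition stab :: "complex^'n^'n \<Rightarrow> (complex^'n^'n) set" where
  "stab e = {g \<in> \<G>. conjugate g e = e}"

lemma stab_G: "g \<in> stab e \<Longrightarrow> g \<in> \<G>"
  by (simp add: stab_def)

lemma stab_commute: "g \<in> stab e \<Longrightarrow> e ** g = g ** e"
  using conjugate_eq_self_iff[of g e] invertible unfolding stab_def by blast

lemma stab_commute_vec: "g \<in> stab e \<Longrightarrow> e *v (g *v v) = g *v (e *v v)"
  using stab_commute[of g e] by (simp add: matrix_vector_mul_assoc)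

lemma stab_mul: "g \<in> stab e \<Longrightarrow> h \<in> stab e \<Longrightarrow> g ** h \<in> stab e"
  unfolding stab_def using conjugate_conjugate[of g h e] by auto

lemma stab_id: "mat 1 \<in> stab e"
  by (simp add: stab_def)

lemma stab_inv: "g \<in> stab e \<Longrightarrow> matrix_inv g \<in> stab e"
  unfolding stab_def using conjugate_inverse(1)[of g e] by auto

end

text \<open>\<open>M\<close> is asked to commute only after multiplication by \<open>e\<close>, that
  is, as operators on the block. It will be instantiated with the whole stabilizer and with the
  preimage of an abelian normal subgroup of the induced group.\<close>

locale commuting_stabilizer = reducible_projections \<G> sa P
  for \<G> :: "(complex^'n^'n) set" and sa P +
  fixes e :: "complex^'n^'n" and M :: "(complex^'n^'n) set"
  assumes e: "atom e" and M: "M \<subseteq> stab e"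
    and M_normal: "\<And>h m. h \<in> stab e \<Longrightarrow> m \<in> M \<Longrightarrow> conjugate h m \<in> M"
    and M_comm: "\<And>m m'. m \<in> M \<Longrightarrow> m' \<in> M \<Longrightarrow> m ** m' ** e = m' ** m ** e"
begin

definition joint_eigenvectors :: "(complex^'n) set" where
  "joint_eigenvectors = {v. e *v v = v \<and> (\<forall>m\<in>M. \<exists>c. m *v v = c *s v)}"

text \<open>Since mg = g(g^-1 m g) and the conjugate is again in \<open>M\<close>, the vector gv is
  an eigenvector of \<open>m\<close>.\<close>

lemma stab_joint_eigenvectors:
  assumes g: "g \<in> stab e" and v: "v \<in> joint_eigenvectors"
  shows "g *v v \<in> joint_eigenvectors"
  unfolding joint_eigenvectors_def
proof (intro CollectI conjI ballI)
  show "e *v (g *v v) = g *v v"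
    using v by (simp add: stab_commute_vec[OF g] joint_eigenvectors_def)
  fix m assume "m \<in> M"
  then obtain c where "conjugate g m *v v = c *s v"
    using v M_normal[OF g] unfolding joint_eigenvectors_def by blast
  then have "g *v (conjugate g m *v v) = c *s (g *v v)"
    by (simp add: vector_scalar_commute)
  moreover have "g ** conjugate g m = m ** g"
    using stab_G[OF g] by (simp add: conjugate_def matrix_inv_cancel flip: matrix_mul_assoc)
  ultimately show "\<exists>c. m *v (g *v v) = c *s (g *v v)"
    by (metis matrix_vector_mul_assoc)
qed

text \<open>Let \<open>W\<close> be the \<G>-invariant subspace generated by the joint eigenvectors.
  Cutting \<open>W\<close> down to the block gives only their span \<open>E\<close>. A projection
  \<open>p\<close> along \<open>W\<close> that commutes with \<G> is then compressed to the block,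
  and a nonzero compression would produce a joint eigenvector outside \<open>E\<close>.\<close>

lemma joint_eigenvectors_span:
  assumes ev: "e *v v = v"
  shows "v \<in> vec.span joint_eigenvectors"
proof -
  let ?J = joint_eigenvectors
  define E where "E = vec.span ?J"
  define W where "W = vec.span {g *v v | g v. g \<in> \<G> \<and> v \<in> ?J}"
  have E0: "vec.subspace E" and W0: "vec.subspace W"
    by (simp_all add: E_def W_def)
  have preimage: "vec.subspace {v. X *v v \<in> S}" if "vec.subspace S" for X :: "complex^'n^'n" and S
    using that by (auto simp: vec.subspace_def matrix_vector_right_distrib vector_scalar_commute)
  have "X *v w \<in> W" if X: "X \<in> \<G>" and w: "w \<in> W" for X w
  proof -
    have "W \<subseteq> {w. X *v w \<in> W}"
      unfolding W_def
    proof (rule vec.span_minimal)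
      show "{g *v v | g v. g \<in> \<G> \<and> v \<in> ?J} \<subseteq> {w. X *v w \<in> vec.span {g *v v | g v. g \<in> \<G> \<and> v \<in> ?J}}"
      proof clarify
        fix g v assume "g \<in> \<G>" "v \<in> ?J"
        then have "(X ** g) *v v \<in> {g *v v | g v. g \<in> \<G> \<and> v \<in> ?J}"
          using mul_closed[OF X] by blast
        then show "X *v (g *v v) \<in> vec.span {g *v v | g v. g \<in> \<G> \<and> v \<in> ?J}"
          by (simp only: matrix_vector_mul_assoc vec.span_base)
      qed
    qed (rule preimage, simp)
    with w show ?thesis by blast
  qed
  then have invW: "invariant_subspace \<G> W"
    using W0 by (simp add: invariant_subspace_def)
  have eW: "e *v w \<in> E" if w: "w \<in> W" for w
  proof -
    have "W \<subseteq> {w. e *v w \<in> E}"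
      unfolding W_def
    proof (rule vec.span_minimal)
      show "{g *v v | g v. g \<in> \<G> \<and> v \<in> ?J} \<subseteq> {w. e *v w \<in> E}"
      proof clarify
        fix g v assume g: "g \<in> \<G>" and v: "v \<in> ?J"
        show "e *v (g *v v) \<in> E"
        proof (cases "g \<in> stab e")
          case True
          then have "g *v v \<in> ?J" using v by (rule stab_joint_eigenvectors)
          then show ?thesis unfolding E_def
            by (simp add: stab_commute_vec[OF True, symmetric] vec.span_base joint_eigenvectors_def)
        next
          case False
          \<comment> \<open>An element outside the stabilizer carries the block into another one: e
            g = g (g^-1 e g), and the bracket annihilates the block of \<open>e\<close>.\<close>
          then have "conjugate g e ** e = 0"
            using g e atom_conjugate[OF e g] by (intro atom_disjoint) (auto simp: stab_def)
          then have "(g ** conjugate g e) *v (e *v v) = 0"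
            by (metis matrix_vector_mul_assoc matrix_vector_mult_0 matrix_vector_mult_0_right)
          moreover have "g ** conjugate g e = e ** g"
            using g by (simp add: conjugate_def matrix_inv_cancel flip: matrix_mul_assoc)
          moreover have "e *v v = v" using v by (simp add: joint_eigenvectors_def)
          ultimately have "e *v (g *v v) = 0"
            by (simp add: matrix_vector_mul_assoc)
          then show ?thesis using vec.subspace_0[OF E0] by simp
        qed
      qed
    qed (rule preimage[OF E0])
    with w show ?thesis by blast
  qed
  obtain U where U: "invariant_subspace \<G> U" "U \<inter> W = {0}"
    and UW: "\<And>v. \<exists>u\<in>U. \<exists>w\<in>W. v = u + w"
    using completely_reducible_complement[OF cr invW] by blast
  have U0: "vec.subspace U" using U(1) by (simp add: invariant_subspace_def)
  obtain p where p: "\<And>u. u \<in> U \<Longrightarrow> p *v u = u" "\<And>w. w \<in> W \<Longrightarrow> p *v w = 0"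
    "\<And>v. p *v v \<in> U" "\<And>v. v - p *v v \<in> W"
    using projection_along_complement[OF U0 W0 U(2) UW] by blast
  \<comment> \<open>Both the range \<open>U\<close> and the kernel \<open>W\<close> of
    \<open>p\<close> are invariant, so \<open>p\<close> is a homomorphism of \<G>-modules.\<close>
  have pg: "p *v (g *v v) = g *v (p *v v)" if g: "g \<in> \<G>" for g v
  proof -
    have "g *v (p *v v) \<in> U" "g *v (v - p *v v) \<in> W"
      using g p(3,4) U(1) invW unfolding invariant_subspace_def by blast+
    then have "p *v (g *v (p *v v)) = g *v (p *v v)" "p *v (g *v (v - p *v v)) = 0"
      using p by blast+
    then show ?thesis by (simp add: matrix_vector_mult_diff_distrib)
  qed
  \<comment> \<open>\<open>T\<close> vanishes on \<open>E\<close> and is the identity of the block modulo \<open>E\<close>, so a joint eigenvector in its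
    range would lie both in \<open>E\<close> and outside it.\<close>
  define T where "T = e ** p ** e"
  have T: "T *v v = e *v (p *v (e *v v))" for v
    by (simp add: T_def flip: matrix_vector_mul_assoc)
  have ee: "e *v (e *v v) = e *v v" for v
    using e by (simp add: matrix_vector_mul_assoc)
  have TE: "T *v v = 0" if v: "v \<in> E" for v
  proof -
    have "E \<subseteq> {v. T *v v \<in> {0}}"
      unfolding E_def
    proof (rule vec.span_minimal)
      show "?J \<subseteq> {v. T *v v \<in> {0}}"
      proof
        fix v assume v: "v \<in> ?J"
        then have "mat 1 *v v \<in> {g *v v | g v. g \<in> \<G> \<and> v \<in> ?J}"
          using id_mem by blast
        then have "v \<in> W"
          unfolding W_def by (simp add: vec.span_base)
        then show "v \<in> {v. T *v v \<in> {0}}"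
          using v p(2) by (simp add: T joint_eigenvectors_def)
      qed
    qed (rule preimage, simp)
    with v show ?thesis by blast
  qed
  have Tdiff: "v - T *v v \<in> E" if "e *v v = v" for v
    using eW[OF p(4)[of v]] that by (simp add: T matrix_vector_mult_diff_distrib)
  have "range ((*v) T) = {0}"
  proof (rule ccontr)
    assume ne: "range ((*v) T) \<noteq> {0}"
    have "\<exists>u\<in>range ((*v) T). u \<noteq> 0 \<and> (\<forall>m\<in>M. \<exists>c. m *v u = c *s u)"
    proof (rule joint_eigenvector)
      show "vec.subspace (range ((*v) T))"
        by (rule vec.subspace_image[OF vec.subspace_UNIV])
      show "range ((*v) T) \<noteq> {0}" by fact
      fix m u assume m: "m \<in> M" and "u \<in> range ((*v) T)"
      then obtain x where "u = T *v x" by blast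
      \<comment> \<open>As an element of the stabilizer, \<open>m\<close> commutes with
        \<open>e\<close>, and as an element of \<G> with \<open>p\<close>, hence with
        \<open>T\<close>.\<close>
      moreover have "m *v u = T *v (m *v x)"
      proof -
        have ms: "m \<in> stab e" and "m \<in> \<G>" using m M stab_G by blast+
        then show ?thesis by (simp add: \<open>u = T *v x\<close> T pg stab_commute_vec[OF ms])
      qed
      ultimately show "m *v u \<in> range ((*v) T)" by simp
    next
      fix m m' u assume m: "m \<in> M" "m' \<in> M" and "u \<in> range ((*v) T)"
      then obtain x where "u = T *v x" by blast
      then have u: "e *v u = u" by (simp add: T ee)
      have "(m ** m' ** e) *v u = (m' ** m ** e) *v u"
        using M_comm[OF m] by simp
      then show "m *v (m' *v u) = m' *v (m *v u)"
        by (simp add: u flip: matrix_vector_mul_assoc)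
    qed
    then obtain u x where u: "u = T *v x" "u \<noteq> 0" "\<forall>m\<in>M. \<exists>c. m *v u = c *s u" by blast
    then have "u \<in> ?J" by (simp add: joint_eigenvectors_def T ee)
    then have "u \<in> E" by (simp add: E_def vec.span_base)
    \<comment> \<open>From u in \<open>E\<close> and ex - u in \<open>E\<close> it follows that ex
      is in \<open>E\<close>, where \<open>T\<close> vanishes, although T(ex) = u is
      nonzero.\<close>
    moreover have Tx: "T *v (e *v x) = u" by (simp add: u T ee)
    moreover have "e *v x - T *v (e *v x) \<in> E" by (intro Tdiff ee)
    ultimately have "e *v x - u + u \<in> E" by (intro vec.subspace_add[OF E0]) simp_all
    then have "T *v (e *v x) = 0" by (intro TE) simp
    with Tx u(2) show False by simp
  qed
  then have "T *v v = 0" by blast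
  then show ?thesis using Tdiff[OF ev] by (simp add: E_def)
qed

text \<open>A spectral idempotent of \<open>m ** e\<close> for a nonzero eigenvalue lies below
  \<open>e\<close> and commutes with its conjugates under the stabilizer, because those of
  \<open>m\<close> commute with \<open>m\<close> on the block. Being nonzero, it must be all of
  \<open>e\<close>.\<close>

lemma acts_as_scalar:
  assumes m: "m \<in> M"
  shows "\<exists>c. \<forall>v. m *v (e *v v) = c *s (e *v v)"
proof -
  let ?J = joint_eigenvectors
  have mG: "m \<in> \<G>" and me: "e ** m = m ** e"
    using m M stab_G stab_commute by blast+
  have ee: "e *v (e *v v) = e *v v" for v
    using e by (simp add: matrix_vector_mul_assoc)
  define T where "T = m ** e"
  have eT: "e ** T = T" and Te: "T ** e = T"
    unfolding T_def by (metis e atom_idem matrix_mul_assoc me)+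
  have T: "T *v v = m *v (e *v v)" for v
    by (simp add: T_def flip: matrix_vector_mul_assoc)
  have "\<exists>u\<in>?J. u \<noteq> 0"
  proof (rule ccontr)
    assume "\<not> (\<exists>u\<in>?J. u \<noteq> 0)"
    then have "?J \<subseteq> {0}" by blast
    then have "vec.span ?J \<subseteq> {0}" by (rule vec.span_minimal) simp
    then have "e *v v = 0" for v
      using joint_eigenvectors_span[OF ee] by blast
    then show False using e by (simp add: atom_def matrix_eq)
  qed
  then obtain u where u: "u \<in> ?J" "u \<noteq> 0" by blast
  then obtain c where c: "m *v u = c *s u"
    using m by (auto simp: joint_eigenvectors_def)
  have eu: "e *v u = u" using u by (simp add: joint_eigenvectors_def)
  \<comment> \<open>The spectral idempotent of \<open>m ** e\<close> for \<open>c\<close> lies below \<open>e\<close> only because \<open>c\<close> is nonzero.\<close>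
  have "c \<noteq> 0"
  proof
    assume "c = 0"
    then have "matrix_inv m *v (m *v u) = 0" using c by simp
    then show False
      using u mG by (simp add: matrix_vector_mul_assoc matrix_inv_cancel)
  qed
  \<comment> \<open>The block is spanned by joint eigenvectors, and its complement, the kernel of
    \<open>e\<close>, lies in the kernel of \<open>T\<close>.\<close>
  have diag: "vec.span {v. \<exists>c. T *v v = c *s v} = UNIV" (is "?S = _")
  proof -
    have "v \<in> ?S" for v
    proof -
      have "?J \<subseteq> {v. \<exists>c. T *v v = c *s v}"
        using m by (auto simp: joint_eigenvectors_def T)
      then have "e *v v \<in> ?S"
        using joint_eigenvectors_span[OF ee] vec.span_mono by blast
      moreover have "T *v (v - e *v v) = 0 *s (v - e *v v)"
        by (simp add: T matrix_vector_mult_diff_distrib ee)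
      then have "v - e *v v \<in> ?S"
        by (intro vec.span_base) blast
      ultimately have "e *v v + (v - e *v v) \<in> ?S" by (rule vec.span_add)
      then show ?thesis by simp
    qed
    then show ?thesis by blast
  qed
  have normal: "T ** adjoint_matrix T = adjoint_matrix T ** T" if sa
  proof -
    have "adjoint_matrix e = e"
      using proj_P[OF atom_P[OF e]] that by (simp add: proj_def)
    moreover have um: "adjoint_matrix m ** m = mat 1" "m ** adjoint_matrix m = mat 1"
      using unitary[OF that mG] by (simp_all add: unitary_matrix_def)
    ultimately have "adjoint_matrix T = adjoint_matrix m ** e" "adjoint_matrix T = e ** adjoint_matrix m"
      by (metis T_def me adjoint_matrix_mul)+
    moreover have "(m ** e) ** (e ** adjoint_matrix m) = e ** (m ** adjoint_matrix m)"
      using e by (metis atom_idem matrix_mul_assoc me)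
    moreover have "(adjoint_matrix m ** e) ** (m ** e) = (adjoint_matrix m ** m) ** e"
      using e by (metis atom_idem matrix_mul_assoc me)
    ultimately show ?thesis unfolding T_def by (simp add: um)
  qed
  obtain d where d: "proj sa d" "\<And>v. T *v v = c *s v \<Longrightarrow> d *v v = v"
    "\<And>v. T *v (d *v v) = c *s (d *v v)" "\<And>B. T ** B = B ** T \<Longrightarrow> d ** B = B ** d"
    using eigenprojection_proj[OF diag normal] by blast
  have "c *s (e *v (d *v v)) = c *s (d *v v)" for v
    by (metis d(3) eT matrix_vector_mul_assoc vector_scalar_commute)
  then have ed: "e ** d = d"
    using \<open>c \<noteq> 0\<close> by (simp add: matrix_eq flip: matrix_vector_mul_assoc)
  have de: "d ** e = d"
    using d(4)[of e] eT Te ed by simp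
  have "d = 0 \<or> d = e"
  proof (rule atom_P_absorb[OF e d(1) de ed])
    fix h assume h: "h \<in> \<G>" and he: "conjugate h e = e"
    \<comment> \<open>The commutant property of \<open>d\<close> is used twice. \<open>T\<close>
      commutes with \<open>conjugate k T\<close>, so \<open>d\<close> does; conjugating by
      \<open>h\<close> shows that \<open>T\<close> commutes with \<open>conjugate h d\<close>, so
      \<open>d\<close> does too.\<close>
    define k where "k = matrix_inv h"
    have k: "k \<in> stab e"
      unfolding k_def using h he by (intro stab_inv) (simp add: stab_def)
    have kG: "invertible k" "invertible h" using stab_G[OF k] h by auto
    define n where "n = conjugate k m"
    have n: "n \<in> M" unfolding n_def using M_normal[OF k m] .
    then have ne: "e ** n = n ** e"
      using M stab_commute by blast
    have kT: "conjugate k T = n ** e"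
      using k kG by (simp add: T_def n_def conjugate_mul) (simp add: stab_def)
    have "T ** (n ** e) = m ** (e ** n) ** e"
      by (simp add: T_def matrix_mul_assoc)
    also have "\<dots> = m ** n ** e"
      unfolding ne using e by (simp add: matrix_mul_assoc) (simp flip: matrix_mul_assoc)
    also have "\<dots> = n ** (m ** e) ** e"
      using M_comm[OF m n] e by (simp add: matrix_mul_assoc) (simp flip: matrix_mul_assoc)
    also have "\<dots> = (n ** e) ** T"
      unfolding me[symmetric] using e by (simp add: T_def matrix_mul_assoc)
    finally have "d ** conjugate k T = conjugate k T ** d"
      unfolding kT by (rule d(4))
    then have "conjugate h (d ** conjugate k T) = conjugate h (conjugate k T ** d)"
      by simp
    moreover have "conjugate h (conjugate k T) = T"
      unfolding k_def using h by (simp add: conjugate_inverse)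
    ultimately have "T ** conjugate h d = conjugate h d ** T"
      using kG by (simp add: conjugate_mul)
    then show "d ** conjugate h d = conjugate h d ** d"
      by (rule d(4))
  qed
  moreover have "d *v u = u"
    by (rule d(2)) (simp add: T eu c)
  ultimately have "d = e" using u(2) by auto
  then have "\<forall>v. m *v (e *v v) = c *s (e *v v)"
    using d(3) by (simp add: T ee)
  then show ?thesis by blast
qed

end

section \<open>The group induced on a block as a subquotient of \<G>\<close>

lemma group_GL: "group (GL :: (complex^'n^'n) monoid)"
proof (rule groupI)
  fix x assume "x \<in> carrier (GL :: (complex^'n^'n) monoid)"
  then have x: "invertible x" by (simp add: GL_def)
  then have "invertible (matrix_inv x)"
    using matrix_inv_cancel(1,2)[OF x] by (auto simp: invertible_def)
  then show "\<exists>y\<in>carrier GL. y \<otimes>\<^bsub>GL\<^esub> x = \<one>\<^bsub>GL\<^esub>"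
    using matrix_inv_cancel(2)[OF x] by (auto simp: GL_def)
qed (auto simp: GL_def invertible_mult matrix_mul_assoc invertible_def[of "mat 1"])

lemma inv_GL:
  fixes x :: "complex^'n^'n"
  assumes x: "invertible x"
  shows "inv\<^bsub>GL\<^esub> x = matrix_inv x"
proof -
  have "invertible (matrix_inv x)"
    using matrix_inv_cancel(1,2)[OF x] by (auto simp: invertible_def)
  then show ?thesis
    using matrix_inv_cancel(2)[OF x] x
    by (intro group.inv_equality[OF group_GL]) (auto simp: GL_def)
qed

locale subquotient_projections = reducible_projections \<G> sa P
  for \<G> :: "(complex^'n^'n) set" and sa P +
  assumes subquotients: "\<And>Q. Q \<in> subquotients (GL\<lparr>carrier := \<G>\<rparr>) \<Longrightarrow> \<not> comm_group Q \<Longrightarrow>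
    has_noncentral_abelian_normal_subgroup Q"
begin

text \<open>Dividing the stabilizer by the kernel \<open>N\<close> of its action on the block gives
  a subquotient \<open>Q\<close>. If \<open>Q\<close> is abelian, the stabilizer itself can serve as
  \<open>M\<close> in \<open>acts_as_scalar\<close>. Otherwise a noncentral abelian normal subgroup
  would act by scalars and so be central.\<close>

lemma stab_acts_as_scalar:
  assumes e: "atom e" and h: "h \<in> stab e"
  shows "\<exists>c. \<forall>v. h *v (e *v v) = c *s (e *v v)"
proof -
  define K where "K = (GL :: (complex^'n^'n) monoid)\<lparr>carrier := stab e\<rparr>"
  define N where "N = {h \<in> stab e. h ** e = e}"
  have carrier [simp]: "carrier K = stab e" and mult [simp]: "x \<otimes>\<^bsub>K\<^esub> y = x ** y"
    and one [simp]: "\<one>\<^bsub>K\<^esub> = mat 1" for x y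
    by (simp_all add: K_def GL_def)
  have stab_inverse: "invertible x" if "x \<in> stab e" for x
    using stab_G[OF that] by simp
  have sub: "subgroup (stab e) GL"
  proof (rule group.subgroupI[OF group_GL])
    show "stab e \<subseteq> carrier GL" using stab_inverse by (auto simp: GL_def)
    show "stab e \<noteq> {}" using stab_id by blast
    show "inv\<^bsub>GL\<^esub> a \<in> stab e" if "a \<in> stab e" for a
      using that by (simp add: inv_GL stab_inverse stab_inv)
    show "a \<otimes>\<^bsub>GL\<^esub> b \<in> stab e" if "a \<in> stab e" "b \<in> stab e" for a b
      using that by (simp add: GL_def stab_mul)
  qed
  have inv: "inv\<^bsub>K\<^esub> x = matrix_inv x" if "x \<in> stab e" for x
    using group.m_inv_consistent[OF group_GL sub that] inv_GL[OF stab_inverse[OF that]]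
    by (simp add: K_def)
  interpret K: group K
    unfolding K_def using group.subgroup_imp_group[OF group_GL sub] .
  have inv_N: "matrix_inv x ** e = e" if "x \<in> stab e" "x ** e = e" for x
    using that matrix_inv_cancel(4)[OF stab_inverse[OF that(1)]] by metis
  have subN: "subgroup N K"
  proof (rule K.subgroupI)
    show "inv\<^bsub>K\<^esub> a \<in> N" if "a \<in> N" for a
      using that inv_N by (simp add: N_def inv stab_inv)
    show "a \<otimes>\<^bsub>K\<^esub> b \<in> N" if "a \<in> N" "b \<in> N" for a b
      using that by (simp add: N_def stab_mul flip: matrix_mul_assoc)
    show "N \<subseteq> carrier K" by (auto simp: N_def)
    have "mat 1 \<in> N" by (simp add: N_def stab_id)
    then show "N \<noteq> {}" by blast
  qed
  have "x ** n ** matrix_inv x \<in> N" if x: "x \<in> stab e" and n: "n \<in> N" for x n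
  proof -
    have "(x ** n ** matrix_inv x) ** e = x ** (n ** e) ** matrix_inv x"
      using stab_commute[OF stab_inv[OF x]] stab_commute[of n e] n
      by (metis (no_types, lifting) N_def matrix_mul_assoc mem_Collect_eq)
    also have "\<dots> = e"
      using n matrix_inv_cancel(5)[OF stab_inverse[OF x]]
      by (simp add: N_def flip: stab_commute[OF x])
    finally show ?thesis
      using n stab_mul x stab_inv by (simp add: N_def)
  qed
  then have "N \<lhd> K"
    using subN by (simp add: K.normal_inv_iff inv)
  then interpret N: normal N K .
  \<comment> \<open>Two elements have the same coset exactly when they agree on the block; the two
    facts \<open>\<pi>_eqI\<close> and \<open>\<pi>_eqD\<close> translate between equations in
    \<open>Q\<close> and equations of matrices times \<open>e\<close>.\<close>
  define \<pi> where "\<pi> x = N #>\<^bsub>K\<^esub> x" for x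
  have \<pi>_eqI: "\<pi> x = \<pi> y" if "x \<in> stab e" "y \<in> stab e" "x ** e = y ** e" for x y
  proof -
    have "(x ** matrix_inv y) ** e = (x ** e) ** matrix_inv y"
      using stab_commute[OF stab_inv[OF that(2)]] by (metis matrix_mul_assoc)
    also have "\<dots> = (e ** y) ** matrix_inv y"
      using that stab_commute[OF that(2)] by simp
    finally have "x ** matrix_inv y \<in> N"
      using that stab_mul stab_inv matrix_inv_cancel(5)[OF stab_inverse[OF that(2)]]
      by (simp add: N_def)
    moreover have "x = (x ** matrix_inv y) ** y"
      using matrix_inv_cancel(6)[OF stab_inverse[OF that(2)]] by simp
    ultimately have "x \<in> N #>\<^bsub>K\<^esub> y"
      unfolding r_coset_def by auto
    then show ?thesis
      unfolding \<pi>_def using K.repr_independence[of x N y] that subN by simp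
  qed
  have \<pi>_eqD: "x ** e = y ** e" if "x \<in> stab e" "y \<in> stab e" "\<pi> x = \<pi> y" for x y
  proof -
    have "x \<in> N #>\<^bsub>K\<^esub> y"
      using that K.rcos_self[of x N] subN by (simp add: \<pi>_def)
    then obtain n where n: "n \<in> N" "x = n ** y" unfolding r_coset_def by auto
    have "x ** e = (n ** e) ** y"
      unfolding n(2) using stab_commute[OF that(2)] by (simp flip: matrix_mul_assoc)
    also have "\<dots> = y ** e"
      using n(1) stab_commute[OF that(2)] by (simp add: N_def)
    finally show ?thesis .
  qed
  define Q where "Q = K Mod N"
  have mult_\<pi>: "\<pi> x \<otimes>\<^bsub>Q\<^esub> \<pi> y = \<pi> (x ** y)" if "x \<in> stab e" "y \<in> stab e" for x y
    using N.rcos_sum[of x y] that by (simp add: Q_def \<pi>_def)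
  have carrier_Q: "carrier Q = \<pi> ` stab e"
    by (simp add: Q_def carrier_FactGroup \<pi>_def)
  have inv_\<pi>: "inv\<^bsub>Q\<^esub> (\<pi> x) = \<pi> (matrix_inv x)" if x: "x \<in> stab e" for x
    using N.inv_FactGroup[of "\<pi> x"] N.rcos_inv[of x] x carrier_Q inv
    by (simp add: Q_def \<pi>_def)
  have Q_sub: "Q \<in> subquotients (GL\<lparr>carrier := \<G>\<rparr>)"
  proof -
    have "subgroup (stab e) (GL\<lparr>carrier := \<G>\<rparr>)"
      using group.subgroup_incl[OF group_GL sub subgroup_GL] stab_G by blast
    moreover have "N \<lhd> (GL\<lparr>carrier := \<G>\<rparr>\<lparr>carrier := stab e\<rparr>)"
      using \<open>N \<lhd> K\<close> by (simp add: K_def)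
    moreover have "Q = (GL\<lparr>carrier := \<G>\<rparr>\<lparr>carrier := stab e\<rparr>) Mod N"
      by (simp add: Q_def K_def)
    ultimately show ?thesis unfolding subquotients_def by blast
  qed
  show ?thesis
  proof (cases "comm_group Q")
    case True
    interpret commuting_stabilizer \<G> sa P e "stab e"
    proof unfold_locales
      fix m m' assume m: "m \<in> stab e" "m' \<in> stab e"
      have "\<pi> m \<otimes>\<^bsub>Q\<^esub> \<pi> m' = \<pi> m' \<otimes>\<^bsub>Q\<^esub> \<pi> m"
        using comm_groupE(4)[OF True] m carrier_Q by blast
      then show "m ** m' ** e = m' ** m ** e"
        using m by (intro \<pi>_eqD) (simp_all add: mult_\<pi> stab_mul)
    next
      show "conjugate h m \<in> stab e" if "h \<in> stab e" "m \<in> stab e" for h m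
        using that unfolding conjugate_def by (intro stab_mul stab_inv)
    qed (use e in auto)
    show ?thesis using acts_as_scalar[OF h] .
  next
    case False
    then obtain M0 where M0: "M0 \<lhd> Q" "comm_group (Q\<lparr>carrier := M0\<rparr>)" "\<not> M0 \<subseteq> group_center Q"
      using subquotients[OF Q_sub] unfolding has_noncentral_abelian_normal_subgroup_def by blast
    \<comment> \<open>Normality of \<open>M0\<close> makes its preimage stable under conjugation by
      the stabilizer, and commutativity of \<open>M0\<close> becomes commutation on the
      block.\<close>
    define M where "M = {m \<in> stab e. \<pi> m \<in> M0}"
    interpret commuting_stabilizer \<G> sa P e M
    proof unfold_locales
      show "M \<subseteq> stab e" by (auto simp: M_def)
      fix h m assume h: "h \<in> stab e" and m: "m \<in> M"
      then have m': "m \<in> stab e" "\<pi> m \<in> M0" by (auto simp: M_def)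
      have "inv\<^bsub>Q\<^esub> (\<pi> h) \<otimes>\<^bsub>Q\<^esub> \<pi> m \<otimes>\<^bsub>Q\<^esub> \<pi> h \<in> M0"
        using normal.inv_op_closed1[OF M0(1)] h m' carrier_Q by blast
      then have "\<pi> (conjugate h m) \<in> M0"
        using h m' by (simp add: inv_\<pi> mult_\<pi> stab_mul stab_inv conjugate_def)
      then show "conjugate h m \<in> M"
        using h m' by (simp add: M_def stab_mul stab_inv conjugate_def)
    next
      fix m m' assume m: "m \<in> M" "m' \<in> M"
      then have "\<pi> m \<otimes>\<^bsub>Q\<^esub> \<pi> m' = \<pi> m' \<otimes>\<^bsub>Q\<^esub> \<pi> m"
        using comm_groupE(4)[OF M0(2)] by (simp add: M_def)
      then show "m ** m' ** e = m' ** m ** e"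
        using m by (intro \<pi>_eqD) (simp_all add: mult_\<pi> stab_mul M_def)
    qed (fact e)
    \<comment> \<open>Operators that are scalar on the block commute there with every element of the
      stabilizer, contrary to the choice of \<open>M0\<close>.\<close>
    have "M0 \<subseteq> group_center Q"
    proof
      fix Z assume Z: "Z \<in> M0"
      then have "Z \<in> carrier Q"
        using normal_imp_subgroup[OF M0(1)] subgroup.subset by blast
      then obtain m where m: "m \<in> stab e" "Z = \<pi> m" unfolding carrier_Q by blast
      then have "m \<in> M" using Z by (simp add: M_def)
      then obtain c where c: "\<And>v. m *v (e *v v) = c *s (e *v v)" using acts_as_scalar by blast
      have "\<pi> m \<otimes>\<^bsub>Q\<^esub> \<pi> x = \<pi> x \<otimes>\<^bsub>Q\<^esub> \<pi> m" if x: "x \<in> stab e" for x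
      proof -
        have "(m ** x ** e) *v v = (x ** m ** e) *v v" for v
        proof -
          have "m *v (x *v (e *v v)) = m *v (e *v (x *v v))"
            by (simp add: stab_commute_vec[OF x])
          also have "\<dots> = c *s (x *v (e *v v))"
            unfolding c by (simp only: stab_commute_vec[OF x])
          also have "\<dots> = x *v (m *v (e *v v))"
            by (simp add: c vector_scalar_commute)
          finally show ?thesis by (simp flip: matrix_vector_mul_assoc)
        qed
        then have "m ** x ** e = x ** m ** e" by (simp add: matrix_eq)
        then have "\<pi> (m ** x) = \<pi> (x ** m)"
          using x m by (intro \<pi>_eqI stab_mul)
        then show ?thesis using x m by (simp add: mult_\<pi>)
      qed
      then show "Z \<in> group_center Q"
        using m by (auto simp: group_center_def carrier_Q)
    qed
    with M0(3) show ?thesis by blast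
  qed
qed

text \<open>The stabilizer acts on the block by scalars, so an idempotent below \<open>e\<close>
  equals its conjugates under the stabilizer. Hence \<open>atom_P_absorb\<close> applies to one of
  rank one.\<close>

lemma atom_rank_one:
  assumes e: "atom e"
  shows "\<exists>v. v \<noteq> 0 \<and> e *v v = v \<and> (\<forall>w. \<exists>c. e *v w = c *s v)"
proof -
  obtain v0 where "e *v v0 \<noteq> 0"
    using e by (auto simp: atom_def matrix_eq)
  define v where "v = e *v v0"
  have v: "v \<noteq> 0" "e *v v = v"
    using \<open>e *v v0 \<noteq> 0\<close> e by (simp_all add: v_def matrix_vector_mul_assoc)
  define q where "q = cinner v v"
  have q: "q \<noteq> 0" using v by (simp add: q_def cinner_self_eq_0)
  have cnj_q: "cnj q = q" by (simp add: q_def cinner_def mult.commute)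
  \<comment> \<open>This is the orthogonal projection onto the line of \<open>v\<close>; that
    \<open>q\<close> is real makes it self-adjoint.\<close>
  define d0 :: "complex^'n^'n" where "d0 = (\<chi> i j. v $ i * cnj (v $ j) / q)"
  have d0: "d0 *v x = (cinner x v / q) *s v" for x
    by (simp add: d0_def vec_eq_iff matrix_vector_mult_def cinner_def sum_divide_distrib
        sum_distrib_left mult_ac)
  have d0_adj: "adjoint_matrix d0 = d0"
    by (simp add: d0_def adjoint_matrix_def vec_eq_iff cnj_q mult.commute)
  have d0v: "d0 *v v = v"
    using q by (simp add: d0 q_def[symmetric])
  \<comment> \<open>The factor \<open>e\<close> on the right places the idempotent below
    \<open>e\<close> even if \<open>e\<close> is not an orthogonal projection.\<close>
  define d where "d = d0 ** e"
  have d: "d *v x = (cinner (e *v x) v / q) *s v" for x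
    by (simp add: d_def d0 flip: matrix_vector_mul_assoc)
  have dv: "d *v v = v"
    by (simp add: d v(2) q q_def[symmetric])
  have ed: "e ** d = d"
    by (simp add: matrix_eq d vector_scalar_commute v flip: matrix_vector_mul_assoc)
  have de: "d ** e = d"
    using e by (simp add: d_def flip: matrix_mul_assoc)
  have dd: "d ** d = d"
  proof -
    have "d *v (d *v x) = d *v x" for x
      unfolding d[of x] by (simp only: vector_scalar_commute dv)
    then show ?thesis by (simp add: matrix_eq flip: matrix_vector_mul_assoc)
  qed
  have "adjoint_matrix d = d" if sa
  proof -
    have ee: "adjoint_matrix e = e"
      using proj_P[OF atom_P[OF e]] that by (simp add: proj_def)
    \<comment> \<open>\<open>e\<close> fixes \<open>v\<close>; taking adjoints of self-adjoint
      factors gives \<open>d0 ** e = d0\<close>, so \<open>d\<close> is just \<open>d0\<close> in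
      this case.\<close>
    have "e ** d0 = d0"
      by (simp add: matrix_eq d0 vector_scalar_commute v flip: matrix_vector_mul_assoc)
    then have "d0 ** e = d0"
      using adjoint_matrix_mul[of e d0] by (simp add: ee d0_adj)
    then show ?thesis by (simp add: d_def d0_adj)
  qed
  with dd have "proj sa d" by (simp add: proj_def)
  then have "d = 0 \<or> d = e"
  proof (rule atom_P_absorb[OF e _ de ed])
    fix h assume "h \<in> \<G>" and "conjugate h e = e"
    then have h: "h \<in> stab e" by (simp add: stab_def)
    obtain c where c: "\<And>v. h *v (e *v v) = c *s (e *v v)"
      using stab_acts_as_scalar[OF e h] by blast
    have 1: "h *v (d *v x) = c *s (d *v x)" for x
      using c[of "d *v x"] ed by (simp add: matrix_vector_mul_assoc)
    have dex: "d *v (e *v y) = d *v y" for y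
      using de by (simp add: matrix_vector_mul_assoc)
    have 2: "d *v (h *v x) = c *s (d *v x)" for x
    proof -
      have "d *v (h *v x) = d *v (e *v (h *v x))"
        by (simp only: dex)
      also have "\<dots> = c *s (d *v (e *v x))"
        by (simp only: stab_commute_vec[OF h] c vector_scalar_commute)
      also have "\<dots> = c *s (d *v x)"
        by (simp only: dex)
      finally show ?thesis .
    qed
    have "d ** h = h ** d"
      by (simp add: matrix_eq 1 2 flip: matrix_vector_mul_assoc)
    then have "conjugate h d = d"
      using stab_G[OF h] by (simp add: conjugate_eq_self_iff)
    then show "d ** conjugate h d = conjugate h d ** d" by simp
  qed
  then have "d = e" using dv v by auto
  then have "\<exists>c. e *v w = c *s v" for w using d by blast
  with v show ?thesis by blast
qed

end

subsection \<open>The algebra spanned by the atoms\<close>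

lemma diagonal_matrix_mul:
  assumes "D \<in> diagonal_matrices"
  shows "(D ** X) $ i $ j = D $ i $ i * X $ i $ j" "(X ** D) $ i $ j = X $ i $ j * D $ j $ j"
proof -
  have "(D ** X) $ i $ j = (\<Sum>k\<in>UNIV. if k = i then D $ i $ i * X $ i $ j else 0)"
    unfolding matrix_matrix_mult_def vec_lambda_beta using assms
    by (intro sum.cong) (auto simp: diagonal_matrices_def)
  then show "(D ** X) $ i $ j = D $ i $ i * X $ i $ j" by simp
  have "(X ** D) $ i $ j = (\<Sum>k\<in>UNIV. if k = j then X $ i $ j * D $ j $ j else 0)"
    unfolding matrix_matrix_mult_def vec_lambda_beta using assms
    by (intro sum.cong) (auto simp: diagonal_matrices_def)
  then show "(X ** D) $ i $ j = X $ i $ j * D $ j $ j" by simp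
qed

lemma diagonal_matrices_commute:
  assumes "D \<in> diagonal_matrices" "E \<in> diagonal_matrices"
  shows "D ** E = E ** D"
proof -
  have "(D ** E) $ i $ j = (E ** D) $ i $ j" for i j
    using assms by (cases "i = j")
      (simp_all add: diagonal_matrix_mul[OF assms(1)] diagonal_matrices_def)
  then show ?thesis by (simp add: vec_eq_iff)
qed

lemma comm_semisimple_commute:
  assumes "comm_semisimple_algebra \<A>" "X \<in> \<A>" "Y \<in> \<A>"
  shows "X ** Y = Y ** X"
proof -
  obtain S where S: "invertible S" "conjugate S X \<in> diagonal_matrices" "conjugate S Y \<in> diagonal_matrices"
    using assms unfolding comm_semisimple_algebra_def conjugate_def by blast
  have "conjugate S (X ** Y) = conjugate S (Y ** X)"
    using diagonal_matrices_commute[OF S(2,3)] S(1) by (simp add: conjugate_mul)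
  then show ?thesis using conjugate_inverse(1)[OF S(1)] by metis
qed

text \<open>The columns of a diagonalizing \<open>S\<close> are eigenvectors of \<open>X\<close>,
  and they span because \<open>S\<close> is invertible.\<close>

lemma comm_semisimple_eigenvectors_span:
  assumes "comm_semisimple_algebra \<A>" "X \<in> \<A>"
  shows "vec.span {v. \<exists>c. X *v v = c *s v} = UNIV"
proof -
  obtain S where S: "invertible S" and D: "conjugate S X \<in> diagonal_matrices"
    using assms unfolding comm_semisimple_algebra_def conjugate_def by blast
  have "X ** S = S ** conjugate S X"
    using matrix_inv_cancel(3)[OF S] by (simp add: conjugate_def flip: matrix_mul_assoc)
  then have XS: "(X ** S) $ i $ j = S $ i $ j * conjugate S X $ j $ j" for i j
    by (simp add: diagonal_matrix_mul(2)[OF D])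
  have "X *v column j S = (conjugate S X $ j $ j) *s column j S" for j
    using XS[of _ j] by (simp add: vec_eq_iff matrix_vector_mult_def matrix_matrix_mult_def column_def mult.commute)
  then have col: "column j S \<in> vec.span {v. \<exists>c. X *v v = c *s v}" for j
    by (intro vec.span_base) blast
  have "v \<in> vec.span {v. \<exists>c. X *v v = c *s v}" for v
  proof -
    have "v = S *v (matrix_inv S *v v)"
      using matrix_inv_cancel(1)[OF S] by (simp add: matrix_vector_mul_assoc)
    also have "\<dots> = (\<Sum>i\<in>UNIV. (matrix_inv S *v v) $ i *s column i S)"
      by (rule matrix_mult_sum)
    also have "\<dots> \<in> vec.span {v. \<exists>c. X *v v = c *s v}"
      by (intro vec.span_sum vec.span_scale col)
    finally show ?thesis .
  qed
  then show ?thesis by blast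
qed

lemma matrix_vector_mul_axis: "A *v axis j 1 = column j (A :: 'a::semiring_1^'n^'m)"
  by (simp add: vec_eq_iff matrix_vector_mult_def column_def axis_def if_distrib cong: if_cong)

lemma adjoint_matrix_id [simp]: "adjoint_matrix (mat 1) = mat 1"
  by (auto simp: adjoint_matrix_def mat_def vec_eq_iff)

text \<open>The spectral idempotents of the members of \<open>\<A>\<close> lie in its bicommutant; working with the latter
  avoids describing them.\<close>

lemma bicommutant_projections:
  assumes G: "matrix_group \<G>" and unitary: "\<And>g. sa \<Longrightarrow> g \<in> \<G> \<Longrightarrow> unitary_matrix g"
    and comm: "\<And>X Y. X \<in> \<A> \<Longrightarrow> Y \<in> \<A> \<Longrightarrow> X ** Y = Y ** X"
    and inv: "conj_invariant \<G> \<A>"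
  shows "commuting_projections \<G> sa
    {d. proj sa d \<and> (\<forall>B. (\<forall>X\<in>\<A>. X ** B = B ** X) \<longrightarrow> d ** B = B ** d)}"
proof -
  interpret matrix_group \<G> by (fact G)
  show ?thesis
  proof (unfold_locales, goal_cases)
    case (1 g)
    then show ?case by (rule unitary)
  next
    case (2 d)
    then show ?case by blast
  next
    case (3 d e)
    \<comment> \<open>Since \<A> is commutative, \<open>X\<close> lies in the commutant of \<A>, so
      \<open>e\<close> commutes with it. Thus \<open>e\<close> itself lies in the commutant, with
      which \<open>d\<close> commutes.\<close>
    have "e ** X = X ** e" if "X \<in> \<A>" for X
      using 3(2) comm that by blast
    then have "\<forall>X\<in>\<A>. X ** e = e ** X" by simp
    with 3(1) show ?case by blast
  next
    case (4 g d)
    then have g: "invertible g" and d: "proj sa d" by auto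
    have "conjugate g d ** B = B ** conjugate g d" if B: "\<forall>X\<in>\<A>. X ** B = B ** X" for B
    proof -
      \<comment> \<open>The invariance of \<A> makes its commutant stable under conjugation by
        \<open>matrix_inv g\<close>; the relation with \<open>d\<close> is then conjugated back by
        \<open>g\<close>.\<close>
      have "X ** conjugate (matrix_inv g) B = conjugate (matrix_inv g) B ** X" if X: "X \<in> \<A>" for X
      proof -
        have "conjugate g X \<in> \<A>"
          using inv X 4(1) by (simp add: conj_invariant_def conjugate_def)
        then have "conjugate (matrix_inv g) (conjugate g X ** B) = conjugate (matrix_inv g) (B ** conjugate g X)"
          using B by simp
        then show ?thesis
          using g 4(1) by (simp add: conjugate_mul conjugate_inverse)
      qed
      then have "d ** conjugate (matrix_inv g) B = conjugate (matrix_inv g) B ** d"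
        using 4(2) by blast
      then have "conjugate g (d ** conjugate (matrix_inv g) B) = conjugate g (conjugate (matrix_inv g) B ** d)"
        by simp
      then show ?thesis
        using g by (simp add: conjugate_mul conjugate_inverse)
    qed
    moreover have "proj sa (conjugate g d)"
      using proj_conjugate[OF g d] unitary 4(1) by blast
    ultimately show ?case by blast
  qed
qed

context maximal_commuting_projections
begin

lemma id_P: "mat 1 \<in> P"
  by (rule mem_P) (simp_all add: proj_def)

lemma id_minus_P:
  assumes a: "a \<in> P"
  shows "mat 1 - a \<in> P"
proof (rule mem_P)
  show "proj sa (mat 1 - a)" using proj_id_minus proj_P a by blast
  show "(mat 1 - a) ** p = p ** (mat 1 - a)" if "p \<in> P" for p
    using comm_P[OF a that] by (simp add: matrix_mul_id_minus)
  show "(mat 1 - a) ** conjugate g (mat 1 - a) = conjugate g (mat 1 - a) ** (mat 1 - a)"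
    if g: "g \<in> \<G>" for g
  proof -
    have "conjugate g (mat 1 - a) = mat 1 - conjugate g a"
      using matrix_inv_cancel(2)[OF invertible[OF g]]
      by (simp add: conjugate_def matrix_eq matrix_vector_mult_diff_distrib
          matrix_vector_mult_diff_rdistrib flip: matrix_vector_mul_assoc)
    then show ?thesis
      using comm_P[OF a conjugate_P[OF g a]] by (simp add: matrix_mul_id_minus)
  qed
qed

text \<open>The eigenvectors of \<open>X\<close> span, so \<open>e\<close> does not kill all of
  them. The spectral idempotent of an eigenvector \<open>u\<close> with eu nonzero belongs to
  \<open>P\<close> and meets the atom, hence contains it.\<close>

lemma scalar_on_atom:
  assumes diag: "vec.span {v. \<exists>c. X *v v = c *s v} = UNIV"
    and normal: "sa \<Longrightarrow> X ** adjoint_matrix X = adjoint_matrix X ** X"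
    and P: "\<And>d. proj sa d \<Longrightarrow> (\<And>B. X ** B = B ** X \<Longrightarrow> d ** B = B ** d) \<Longrightarrow> d \<in> P"
    and e: "atom e"
  shows "\<exists>c. \<forall>v. X *v (e *v v) = c *s (e *v v)"
proof -
  have "\<exists>v c. X *v v = c *s v \<and> e *v v \<noteq> 0"
  proof (rule ccontr)
    assume "\<not> (\<exists>v c. X *v v = c *s v \<and> e *v v \<noteq> 0)"
    then have "{v. \<exists>c. X *v v = c *s v} \<subseteq> {v. e *v v = 0}" by blast
    moreover have "vec.subspace {v. e *v v = 0}"
      by (auto simp: vec.subspace_def matrix_vector_right_distrib vector_scalar_commute)
    ultimately have "vec.span {v. \<exists>c. X *v v = c *s v} \<subseteq> {v. e *v v = 0}"
      by (rule vec.span_minimal)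
    then have "e = 0" unfolding diag by (auto simp: matrix_eq)
    then show False using e by (simp add: atom_def)
  qed
  then obtain u c where u: "X *v u = c *s u" "e *v u \<noteq> 0" by blast
  obtain d where d: "proj sa d" "\<And>v. X *v v = c *s v \<Longrightarrow> d *v v = v"
    "\<And>v. X *v (d *v v) = c *s (d *v v)" "\<And>B. X ** B = B ** X \<Longrightarrow> d ** B = B ** d"
    using eigenprojection_proj[OF diag normal] by blast
  have dP: "d \<in> P" using P d(1,4) by blast
  have "(d ** e) *v u = e *v (d *v u)"
    using comm_P[OF dP atom_P[OF e]] by (simp add: matrix_vector_mul_assoc)
  also have "\<dots> = e *v u" using d(2)[OF u(1)] by simp
  finally have "d ** e \<noteq> 0" using u(2) by auto
  then have "d ** e = e" using e dP by (auto simp: atom_def)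
  then have "X *v (e *v v) = c *s (e *v v)" for v
    using d(3)[of "e *v v"] by (simp add: matrix_vector_mul_assoc)
  then show ?thesis by blast
qed

end

section \<open>The basis of lines given by atoms of rank one\<close>

locale rank_one_atoms = maximal_commuting_projections \<G> sa P
  for \<G> :: "(complex^'n^'n) set" and sa P +
  fixes v :: "complex^'n^'n \<Rightarrow> complex^'n"
  assumes v_nonzero: "atom a \<Longrightarrow> v a \<noteq> 0"
    and v_fixed: "atom a \<Longrightarrow> a *v v a = v a"
    and v_range: "atom a \<Longrightarrow> \<exists>c. a *v w = c *s v a"
begin

lemma v_orthogonal:
  assumes "atom a" "atom b" "a \<noteq> b"
  shows "a *v v b = 0"
proof -
  have "a *v (b *v v b) = 0"
    using atom_disjoint[OF assms] by (simp add: matrix_vector_mul_assoc)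
  then show ?thesis using v_fixed[OF assms(2)] by simp
qed

lemma inj_v: "inj_on v {a. atom a}"
  using v_orthogonal v_fixed v_nonzero by (metis inj_onI mem_Collect_eq)

text \<open>Applying the atom \<open>a\<close> to a vanishing combination isolates the coefficient
  of \<open>v a\<close>.\<close>

lemma independent_v: "vec.independent (v ` {a. atom a})"
  unfolding vec.independent_explicit_module
proof (intro allI impI)
  fix t u w assume t: "finite t" "t \<subseteq> v ` {a. atom a}" "(\<Sum>x\<in>t. u x *s x) = 0" "w \<in> t"
  then obtain a where a: "atom a" "w = v a" by blast
  have "a *v x = (if x = w then w else 0)" if "x \<in> t" for x
  proof -
    obtain b where "atom b" "x = v b" using t(2) \<open>x \<in> t\<close> by blast
    then show ?thesis using a v_orthogonal[of a b] v_fixed[of a] by auto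
  qed
  then have "a *v (\<Sum>x\<in>t. u x *s x) = (\<Sum>x\<in>t. if x = w then u x *s w else 0)"
    by (simp only: vec.sum vector_scalar_commute) (intro sum.cong, auto)
  also have "\<dots> = u w *s w" using t by simp
  finally have "u w *s w = 0" using t(3) by simp
  then show "u w = 0" using v_nonzero a by simp
qed

lemma finite_atoms: "finite {a. atom a}"
  using vec.finiteI_independent[OF independent_v] inj_v by (rule finite_imageD)

text \<open>The idempotent \<open>f\<close> is the product of the complements of the atoms in
  \<open>F\<close>; the mixed terms vanish because distinct atoms have product 0.\<close>

lemma complement_of_atoms:
  assumes "finite F" "F \<subseteq> {a. atom a}"
  shows "\<exists>f\<in>P. \<forall>x. f *v x = x - (\<Sum>a\<in>F. a *v x)"
  using assms
proof (induction F rule: finite_induct)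
  case empty
  then show ?case using id_P by (intro bexI[of _ "mat 1"]) auto
next
  case (insert b F)
  then obtain f where f: "f \<in> P" "\<And>x. f *v x = x - (\<Sum>a\<in>F. a *v x)" by auto
  have b: "atom b" using insert by simp
  have "(\<Sum>a\<in>F. a *v (b *v x)) = 0" for x
  proof (rule sum.neutral, rule ballI)
    fix a assume "a \<in> F"
    then have "a ** b = 0" using insert by (intro atom_disjoint) auto
    then show "a *v (b *v x) = 0" by (simp add: matrix_vector_mul_assoc)
  qed
  then have "(f ** (mat 1 - b)) *v x = x - (\<Sum>a\<in>insert b F. a *v x)" for x
    using insert(1,2)
    by (simp add: f(2) matrix_vector_mult_diff_rdistrib matrix_vector_mult_diff_distrib
        sum_subtractf flip: matrix_vector_mul_assoc)
  then show ?case
    using mul_P[OF f(1) id_minus_P[OF atom_P[OF b]]] by blast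
qed

text \<open>If the remainder \<open>f\<close> were nonzero, there would be an atom \<open>b\<close>
  below it. But \<open>f\<close> kills \<open>v b\<close>, since \<open>b\<close> is among the atoms
  subtracted.\<close>

lemma sum_atoms: "(\<Sum>a | atom a. a *v x) = x"
proof -
  obtain f where f: "f \<in> P" "\<And>x. f *v x = x - (\<Sum>a | atom a. a *v x)"
    using complement_of_atoms[OF finite_atoms subset_refl] by blast
  have "f = 0"
  proof (rule ccontr)
    assume "f \<noteq> 0"
    then obtain b where b: "atom b" "f ** b = b" using atom_below f(1) by blast
    have "f *v v b = v b - (\<Sum>a | atom a. a *v v b)" by (rule f(2))
    also have "(\<Sum>a | atom a. a *v v b) = (\<Sum>a | atom a. if a = b then v b else 0)"
      using v_orthogonal v_fixed b by (intro sum.cong) auto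
    also have "\<dots> = v b" using b finite_atoms by simp
    finally have "f *v (b *v v b) = 0" using v_fixed[OF b(1)] by simp
    then have "b *v v b = 0" using b(2) by (simp add: matrix_vector_mul_assoc)
    then show False using v_fixed v_nonzero b(1) by simp
  qed
  then show ?thesis using f(2)[of x] by simp
qed

lemma span_v: "vec.span (v ` {a. atom a}) = UNIV"
proof -
  have "x \<in> vec.span (v ` {a. atom a})" for x
  proof -
    have "a *v x \<in> vec.span (v ` {a. atom a})" if a: "atom a" for a
    proof -
      obtain c where "a *v x = c *s v a" using v_range[OF a] by blast
      then show ?thesis using a by (simp add: vec.span_scale vec.span_base)
    qed
    then have "(\<Sum>a | atom a. a *v x) \<in> vec.span (v ` {a. atom a})"
      by (intro vec.span_sum) auto
    then show ?thesis by (simp only: sum_atoms)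
  qed
  then show ?thesis by blast
qed

lemma matrix_eq_on_atoms:
  assumes "\<And>a. atom a \<Longrightarrow> X *v v a = Y *v v a"
  shows "X = Y"
proof -
  have "vec.span (v ` {a. atom a}) \<subseteq> {x. X *v x = Y *v x}"
    using assms by (intro vec.span_minimal)
      (auto simp: vec.subspace_def matrix_vector_right_distrib vector_scalar_commute)
  then show ?thesis unfolding span_v by (auto simp: matrix_eq)
qed

text \<open>This is also the commutant of the set of atoms, the description behind self-adjointness
  and maximality.\<close>

definition diagonal_algebra :: "(complex^'n^'n) set" where
  "diagonal_algebra = {X. \<forall>a. atom a \<longrightarrow> (\<exists>c. X *v v a = c *s v a)}"

lemma max_comm_semisimple_diagonal_algebra: "max_comm_semisimple_algebra diagonal_algebra"
proof -
  have "card (v ` {a. atom a}) = CARD('n)"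
    using vec.indep_card_eq_dim_span[OF independent_v] by (simp only: span_v vec_dim_card)
  then have "card {a. atom a} = CARD('n)"
    by (simp only: card_image[OF inj_v])
  \<comment> \<open>There are as many atoms as coordinates, so they can be indexed by the type
    \<open>'n\<close> and their vectors used as the columns of \<open>S\<close>.\<close>
  then obtain \<beta> :: "'n \<Rightarrow> complex^'n^'n" where \<beta>: "bij_betw \<beta> UNIV {a. atom a}"
    using finite_same_card_bij[of "UNIV :: 'n set" "{a. atom a}"] finite_atoms by auto
  have atom_\<beta>: "atom (\<beta> j)" for j
    using bij_betwE[OF \<beta>] by blast
  define S :: "complex^'n^'n" where "S = (\<chi> i j. v (\<beta> j) $ i)"
  have col: "column j S = v (\<beta> j)" for j
    by (simp add: S_def column_def vec_eq_iff)
  have "columns S = v ` \<beta> ` UNIV"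
    by (auto simp: columns_def col)
  also have "\<beta> ` UNIV = {a. atom a}"
    using \<beta> by (simp add: bij_betw_def)
  finally have "columns S = v ` {a. atom a}" .
  then have S: "invertible S"
    using span_v by (simp add: invertible_right_inverse matrix_right_invertible_span_columns)
  have axis: "S *v axis j 1 = v (\<beta> j)" "matrix_inv S *v v (\<beta> j) = axis j 1" for j
  proof -
    show 1: "S *v axis j 1 = v (\<beta> j)" by (simp add: matrix_vector_mul_axis col)
    show "matrix_inv S *v v (\<beta> j) = axis j 1"
      unfolding 1[symmetric] using matrix_inv_cancel(2)[OF S] by (simp add: matrix_vector_mul_assoc)
  qed
  have "diagonal_algebra = (\<lambda>D. S ** D ** matrix_inv S) ` diagonal_matrices"
  proof (intro equalityI subsetI)
    fix X assume X: "X \<in> diagonal_algebra"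
    define D where "D = matrix_inv S ** X ** S"
    have "D $ i $ j = 0" if "i \<noteq> j" for i j
    proof -
      obtain c where "X *v v (\<beta> j) = c *s v (\<beta> j)"
        using X atom_\<beta> by (auto simp: diagonal_algebra_def)
      then have "D *v axis j 1 = c *s axis j 1"
        by (simp add: D_def axis vector_scalar_commute flip: matrix_vector_mul_assoc)
      then have "column j D $ i = (c *s axis j 1) $ i"
        by (simp add: matrix_vector_mul_axis)
      then show ?thesis using that by (simp add: column_def axis_def)
    qed
    then have "D \<in> diagonal_matrices" by (simp add: diagonal_matrices_def)
    moreover have "X = S ** D ** matrix_inv S"
      using matrix_inv_cancel[OF S] by (simp add: D_def matrix_mul_assoc)
    ultimately show "X \<in> (\<lambda>D. S ** D ** matrix_inv S) ` diagonal_matrices" by blast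
  next
    fix X assume "X \<in> (\<lambda>D. S ** D ** matrix_inv S) ` diagonal_matrices"
    then obtain D where D: "D \<in> diagonal_matrices" "X = S ** D ** matrix_inv S" by blast
    have "\<exists>c. X *v v a = c *s v a" if a: "atom a" for a
    proof -
      have "a \<in> range \<beta>" using \<beta> a by (simp add: bij_betw_def)
      then obtain j where j: "a = \<beta> j" by blast
      have "D *v axis j 1 = (D $ j $ j) *s axis j 1"
        unfolding matrix_vector_mul_axis using D(1)
        by (auto simp: column_def vec_eq_iff axis_def diagonal_matrices_def)
      then have "X *v v a = (D $ j $ j) *s v a"
        by (simp add: j D(2) axis vector_scalar_commute flip: matrix_vector_mul_assoc)
      then show ?thesis by blast
    qed
    then show "X \<in> diagonal_algebra" by (simp add: diagonal_algebra_def)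
  qed
  then show ?thesis using S by (auto simp: max_comm_semisimple_algebra_def)
qed

text \<open>\<open>g\<close> carries the line of \<open>a\<close> to the line of the atom g a g^-1,
  on which \<open>X\<close> acts by a scalar.\<close>

lemma conj_invariant_diagonal_algebra: "conj_invariant \<G> diagonal_algebra"
  unfolding conj_invariant_def
proof (intro ballI)
  fix X g assume X: "X \<in> diagonal_algebra" and g: "g \<in> \<G>"
  have "\<exists>c. (matrix_inv g ** X ** g) *v v a = c *s v a" if a: "atom a" for a
  proof -
    define b where "b = conjugate (matrix_inv g) a"
    have b: "atom b" using atom_conjugate[OF a inv_closed[OF g]] by (simp add: b_def)
    have "b ** g = g ** a"
      using g by (simp add: b_def conjugate_def matrix_inv_inv matrix_inv_cancel)
    then have "g *v v a = b *v (g *v v a)"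
      using v_fixed[OF a] by (simp add: matrix_vector_mul_assoc) (simp flip: matrix_vector_mul_assoc)
    moreover obtain k where "b *v (g *v v a) = k *s v b"
      using v_range[OF b] by blast
    moreover obtain c where "X *v v b = c *s v b"
      using X b by (auto simp: diagonal_algebra_def)
    ultimately have "X *v (g *v v a) = c *s (g *v v a)"
      by (metis vector_scalar_commute vec.scale_left_commute)
    then have "(matrix_inv g ** X ** g) *v v a = c *s ((matrix_inv g ** g) *v v a)"
      by (simp add: vector_scalar_commute flip: matrix_vector_mul_assoc)
    then show ?thesis using g by (auto simp: matrix_inv_cancel)
  qed
  then show "matrix_inv g ** X ** g \<in> diagonal_algebra"
    by (simp add: diagonal_algebra_def)
qed

lemma atom_mem_diagonal_algebra:
  assumes "atom a"
  shows "a \<in> diagonal_algebra"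
  unfolding diagonal_algebra_def
proof (intro CollectI allI impI)
  fix b assume "atom b"
  then have "a *v v b = (if a = b then 1 else 0) *s v b"
    using v_orthogonal v_fixed assms by auto
  then show "\<exists>c. a *v v b = c *s v b" by blast
qed

lemma diagonal_algebra_commute:
  assumes X: "X \<in> diagonal_algebra" and Y: "Y \<in> diagonal_algebra"
  shows "X ** Y = Y ** X"
proof (rule matrix_eq_on_atoms)
  fix a assume a: "atom a"
  obtain c where "X *v v a = c *s v a" using X a by (auto simp: diagonal_algebra_def)
  moreover obtain k where "Y *v v a = k *s v a" using Y a by (auto simp: diagonal_algebra_def)
  ultimately show "(X ** Y) *v v a = (Y ** X) *v v a"
    by (simp add: vector_scalar_commute mult.commute flip: matrix_vector_mul_assoc)
qed

text \<open>A matrix that commutes with \<open>a\<close> preserves its range, which is the line of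
  \<open>v a\<close>.\<close>

lemma commutant_diagonal_algebra:
  assumes "\<And>a. atom a \<Longrightarrow> Y ** a = a ** Y"
  shows "Y \<in> diagonal_algebra"
  unfolding diagonal_algebra_def
proof (intro CollectI allI impI)
  fix a assume a: "atom a"
  have "Y *v v a = (Y ** a) *v v a"
    using v_fixed[OF a] by (simp flip: matrix_vector_mul_assoc)
  also have "\<dots> = a *v (Y *v v a)"
    using assms[OF a] by (simp add: matrix_vector_mul_assoc)
  finally show "\<exists>c. Y *v v a = c *s v a" using v_range[OF a, of "Y *v v a"] by simp
qed

lemma matrix_subalgebra_diagonal_algebra: "matrix_subalgebra diagonal_algebra"
  unfolding matrix_subalgebra_def
proof (intro conjI ballI allI)
  show "0 \<in> diagonal_algebra"
    by (auto simp: diagonal_algebra_def intro: exI[of _ 0])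
  fix X Y assume X: "X \<in> diagonal_algebra" and Y: "Y \<in> diagonal_algebra"
  show "X + Y \<in> diagonal_algebra" "X ** Y \<in> diagonal_algebra"
  proof -
    have "(\<exists>k. (X + Y) *v v a = k *s v a) \<and> (\<exists>k. (X ** Y) *v v a = k *s v a)" if a: "atom a" for a
    proof -
      obtain c where "X *v v a = c *s v a" using X a by (auto simp: diagonal_algebra_def)
      moreover obtain k where "Y *v v a = k *s v a" using Y a by (auto simp: diagonal_algebra_def)
      ultimately have "(X + Y) *v v a = (c + k) *s v a" "(X ** Y) *v v a = (k * c) *s v a"
        by (simp_all add: matrix_vector_mult_add_rdistrib vec.scale_left_distrib vector_scalar_commute
            flip: matrix_vector_mul_assoc)
      then show ?thesis by blast
    qed
    then show "X + Y \<in> diagonal_algebra" "X ** Y \<in> diagonal_algebra"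
      by (simp_all add: diagonal_algebra_def)
  qed
next
  fix c X assume X: "X \<in> diagonal_algebra"
  have "(\<chi> i j. c * X $ i $ j) *v x = c *s (X *v x)" for x
    by (simp add: vec_eq_iff matrix_vector_mult_def sum_distrib_left mult.assoc)
  moreover have "\<exists>k. c *s (X *v v a) = k *s v a" if "atom a" for a
  proof -
    obtain k where "X *v v a = k *s v a" using X \<open>atom a\<close> by (auto simp: diagonal_algebra_def)
    then have "c *s (X *v v a) = (c * k) *s v a" by simp
    then show ?thesis by blast
  qed
  ultimately show "(\<chi> i j. c * X $ i $ j) \<in> diagonal_algebra"
    by (simp add: diagonal_algebra_def)
qed

text \<open>The atoms are self-adjoint, so their commutant is closed under adjoints. An abelian
  algebra containing \<open>diagonal_algebra\<close> contains the atoms and hence lies in their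
  commutant.\<close>

lemma masa_diagonal_algebra:
  assumes sa
  shows "masa diagonal_algebra"
proof -
  have "adjoint_matrix X \<in> diagonal_algebra" if X: "X \<in> diagonal_algebra" for X
  proof (rule commutant_diagonal_algebra)
    fix a assume a: "atom a"
    have "adjoint_matrix a = a"
      using proj_P[OF atom_P[OF a]] \<open>sa\<close> by (simp add: proj_def)
    moreover have "X ** a = a ** X"
      using diagonal_algebra_commute[OF X atom_mem_diagonal_algebra[OF a]] .
    ultimately show "adjoint_matrix X ** a = a ** adjoint_matrix X"
      by (metis adjoint_matrix_mul)
  qed
  then have "abelian_self_adjoint_algebra diagonal_algebra"
    using matrix_subalgebra_diagonal_algebra diagonal_algebra_commute
    by (simp add: abelian_self_adjoint_algebra_def self_adjoint_set_def)
  moreover have "C = diagonal_algebra"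
    if C: "abelian_self_adjoint_algebra C" "diagonal_algebra \<subseteq> C" for C
  proof
    show "C \<subseteq> diagonal_algebra"
    proof
      fix Y assume "Y \<in> C"
      then show "Y \<in> diagonal_algebra"
        using C atom_mem_diagonal_algebra
        by (intro commutant_diagonal_algebra) (auto simp: abelian_self_adjoint_algebra_def)
    qed
  qed (fact C(2))
  ultimately show ?thesis by (simp add: masa_def)
qed

end

text \<open>The flag gives both halves of the theorem at once: for \<open>False\<close> the last
  hypothesis and the final implication are vacuous.\<close>

lemma invariant_extension:
  fixes \<G> \<A> :: "(complex^'n^'n) set"
  assumes G: "subgroup \<G> GL" and cr: "completely_reducible \<G>"
    and A: "comm_semisimple_algebra \<A>" and inv: "conj_invariant \<G> \<A>"
    and subq: "\<And>Q. Q \<in> subquotients (GL\<lparr>carrier := \<G>\<rparr>) \<Longrightarrow> \<not> comm_group Q \<Longrightarrow>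
           has_noncentral_abelian_normal_subgroup Q"
    and sa: "sa \<Longrightarrow> (\<forall>G\<in>\<G>. unitary_matrix G) \<and> self_adjoint_set \<A>"
  shows "\<exists>\<B>. max_comm_semisimple_algebra \<B> \<and> conj_invariant \<G> \<B> \<and> \<A> \<subseteq> \<B> \<and> (sa \<longrightarrow> masa \<B>)"
proof -
  let ?P0 = "{d. proj sa d \<and> (\<forall>B. (\<forall>X\<in>\<A>. X ** B = B ** X) \<longrightarrow> d ** B = B ** d)}"
  have "commuting_projections \<G> sa ?P0"
    using G sa inv comm_semisimple_commute[OF A]
    by (intro bicommutant_projections) (auto simp: matrix_group_def)
  then obtain P where P: "?P0 \<subseteq> P" "commuting_projections \<G> sa P"
    and max: "\<And>R. commuting_projections \<G> sa R \<Longrightarrow> P \<subseteq> R \<Longrightarrow> R = P"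
    using commuting_projections.maximal_extension[of \<G> sa ?P0] by blast
  interpret commuting_projections \<G> sa P by (fact P(2))
  interpret subquotient_projections \<G> sa P
    by unfold_locales (fact max cr subq)+
  have "\<exists>v. \<forall>a. atom a \<longrightarrow> v a \<noteq> 0 \<and> a *v v a = v a \<and> (\<forall>w. \<exists>c. a *v w = c *s v a)"
    using atom_rank_one by (intro choice) blast
  then obtain v where v: "\<And>a. atom a \<Longrightarrow> v a \<noteq> 0 \<and> a *v v a = v a \<and> (\<forall>w. \<exists>c. a *v w = c *s v a)"
    by blast
  interpret rank_one_atoms \<G> sa P v
    by unfold_locales (use v in blast)+
  have "\<A> \<subseteq> diagonal_algebra"
  proof
    fix X assume X: "X \<in> \<A>"
    have "\<exists>c. X *v v a = c *s v a" if a: "atom a" for a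
    proof -
      have "\<exists>c. \<forall>w. X *v (a *v w) = c *s (a *v w)"
      proof (rule scalar_on_atom[OF comm_semisimple_eigenvectors_span[OF A X] _ _ a])
        show "X ** adjoint_matrix X = adjoint_matrix X ** X" if sa
          using sa[OF that] X comm_semisimple_commute[OF A X] by (simp add: self_adjoint_set_def)
        \<comment> \<open>What commutes with \<A> commutes with \<open>X\<close>, so
          \<open>d\<close>, which commutes with everything that commutes with \<open>X\<close>, lies
          in the bicommutant family \<open>?P0\<close>.\<close>
        show "d \<in> P" if "proj sa d" "\<And>B. X ** B = B ** X \<Longrightarrow> d ** B = B ** d" for d
          using that X P(1) by blast
      qed
      then show ?thesis using v_fixed[OF a] by metis
    qed
    then show "X \<in> diagonal_algebra" by (simp add: diagonal_algebra_def)
  qed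
  then show ?thesis
    using max_comm_semisimple_diagonal_algebra conj_invariant_diagonal_algebra masa_diagonal_algebra
    by blast
qed

theorem corollary4:
  fixes \<G> \<A> :: "(complex^'n^'n) set"
  assumes "subgroup \<G> GL"
    and "completely_reducible \<G>"
    and "comm_semisimple_algebra \<A>"
    and "conj_invariant \<G> \<A>"
    and "\<And>Q. Q \<in> subquotients (GL\<lparr>carrier := \<G>\<rparr>) \<Longrightarrow> \<not> comm_group Q \<Longrightarrow>
           has_noncentral_abelian_normal_subgroup Q"
  shows "(\<exists>\<B>. max_comm_semisimple_algebra \<B> \<and> conj_invariant \<G> \<B> \<and> \<A> \<subseteq> \<B>) \<and>
    ((\<forall>G\<in>\<G>. unitary_matrix G) \<and> self_adjoint_set \<A> \<longrightarrow>
      (\<exists>\<B>. max_comm_semisimple_algebra \<B> \<and> masa \<B> \<and> conj_invariant \<G> \<B> \<and> \<A> \<subseteq> \<B>))"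
proof (intro conjI impI)
  show "\<exists>\<B>. max_comm_semisimple_algebra \<B> \<and> conj_invariant \<G> \<B> \<and> \<A> \<subseteq> \<B>"
    using invariant_extension[of \<G> \<A> False] assms by blast
  show "\<exists>\<B>. max_comm_semisimple_algebra \<B> \<and> masa \<B> \<and> conj_invariant \<G> \<B> \<and> \<A> \<subseteq> \<B>"
    if "(\<forall>G\<in>\<G>. unitary_matrix G) \<and> self_adjoint_set \<A>"
    using invariant_extension[of \<G> \<A> True] assms that by blast
qed

end
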